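(* Let $T=\{t_0<t_1<\cdots\}\subseteq\omega$ satisfy $\dfrac{t_j}{t_{j+1}}\to0$ as $j\to\infty$. If $\mathcal U$ is any free ultrafilter on $\omega$ containing $T$, then $\operatorname{supp}\widetilde d_{\mathcal U}$ is not approximable and $c_{0,\mathcal I_{\mathcal U}}$ is not complemented in $\ell_\infty$.
   Context: For a free ultrafilter $\mathcal U$ on $\omega$ and $A\subseteq\omega$, $d_{\mathcal U}(A)=\mathcal U\text{-}\lim_n \frac{|A\cap[0,n)|}{n}$, a finitely additive probability measure on $\mathcal P(\omega)$, and $\mathcal I_{\mathcal U}=\{A\subseteq\omega:d_{\mathcal U}(A)=0\}$. $\beta\omega$ is the space of ultrafilters on $\omega$ with basic clopen sets $\widehat A=\{p:A\in p\}$; $\widetilde d_{\mathcal U}$ is the unique Radon probability measure on $\beta\omega$ with $\widetilde d_{\mathcal U}(\widehat A)=d_{\mathcal U}(A)$ for all $A\subseteq\omega$, and $\operatorname{supp}$ denotes its (closed) support. A compact Hausdorff space $K$ is approximable if the closed unit ball of $M(K)=C(K)^*$ is separable in the weak-star topology $\sigma(M(K),C(K))$. For an ideal $\mathcal I$ on $\omega$, $c_{0,\mathcal I}$ is the closed subspace of $\ell_\infty$ of all bounded scalar sequences $(x_n)$ with $\{n:|x_n|\ge\varepsilon\}\in\mathcal I$ for every $\varepsilon>0$. A closed subspace is complemented if it is the range of a bounded linear projection. *)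

theory Defs
  imports "HOL-Analysis.Analysis" "HOL-Probability.Probability_Measure"
begin

section \<open>Ultrafilters and ultrafilter densities\<close>

text \<open>
  A family \<open>\<U>\<close> of subsets of \<open>\<omega>\<close> is represented by an Isabelle filter \<open>F\<close>, where
  \<open>A \<in> \<U>\<close> reads \<open>\<forall>\<^sub>F n in F. n \<in> A\<close>.
\<close>

definition ultrafilter :: "'a filter \<Rightarrow> bool"
  where "ultrafilter F \<longleftrightarrow>
    F \<noteq> bot \<and> (\<forall>P. (\<forall>\<^sub>F x in F. P x) \<or> (\<forall>\<^sub>F x in F. \<not> P x))"

definition free_ultrafilter :: "'a filter \<Rightarrow> bool"
  where "free_ultrafilter F \<longleftrightarrow> ultrafilter F \<and> (\<forall>a. \<forall>\<^sub>F x in F. x \<noteq> a)"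

definition density :: "nat filter \<Rightarrow> nat set \<Rightarrow> real"
  where "density U A = Lim U (\<lambda>n. real (card (A \<inter> {..<n})) / real n)"

definition null_ideal :: "nat filter \<Rightarrow> nat set set"
  where "null_ideal U = {A. density U A = 0}"

section \<open>The space \<open>\<beta>\<omega>\<close> and Radon measures\<close>

definition hat :: "nat set \<Rightarrow> nat filter set"
  where "hat A = {p. ultrafilter p \<and> (\<forall>\<^sub>F n in p. n \<in> A)}"

definition beta_omega :: "nat filter topology"
  where "beta_omega = topology_generated_by (range hat)"

text \<open>
  Radon probability measures are taken on the Borel sets. For Hausdorff \<open>X\<close>, as in our use,
  compact sets are closed, so the supremum ranges over measurable sets.
\<close>

definition radon_probability :: "'a topology \<Rightarrow> 'a measure \<Rightarrow> bool"
  where "radon_probability X M \<longleftrightarrow>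
    prob_space M \<and> space M = topspace X \<and>
    sets M = sigma_sets (topspace X) {V. openin X V} \<and>
    (\<forall>B\<in>sets M. emeasure M B = (SUP C\<in>{C. compactin X C \<and> C \<subseteq> B}. emeasure M C))"

definition measure_support :: "'a topology \<Rightarrow> 'a measure \<Rightarrow> 'a set"
  where "measure_support X M =
    {x \<in> topspace X. \<forall>V. openin X V \<and> x \<in> V \<longrightarrow> emeasure M V > 0}"

definition density_measure :: "nat filter \<Rightarrow> nat filter measure"
  where "density_measure U =
    (THE M. radon_probability beta_omega M \<and> (\<forall>A. measure M (hat A) = density U A))"

section \<open>Approximable compact spaces\<close>

text \<open>
  The scalar field is a type parameter \<open>'k\<close>, used below for the reals and the complex numbers.
  Elements of \<open>C(K)\<close>, and functionals on \<open>C(K)\<close>, are functions fixed to \<open>undefined\<close>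
  outside their domain, so that HOL equality agrees with equality on the domain.
\<close>

definition cont_space :: "'a topology \<Rightarrow> ('a \<Rightarrow> 'k::real_normed_field) set"
  where "cont_space K = {f \<in> extensional (topspace K). continuous_map K euclidean f}"

text \<open>
  For compact \<open>K\<close> every element of \<open>C(K)\<close> is bounded, and the last condition says that the
  operator norm of \<open>\<phi>\<close> with respect to the supremum norm is at most 1.
\<close>

definition dual_unit_ball :: "'a topology \<Rightarrow> (('a \<Rightarrow> 'k::real_normed_field) \<Rightarrow> 'k) set"
  where "dual_unit_ball K =
    {\<phi> \<in> extensional (cont_space K).
      (\<forall>f\<in>cont_space K. \<forall>g\<in>cont_space K. \<phi> (\<lambda>x\<in>topspace K. f x + g x) = \<phi> f + \<phi> g) \<and>
      (\<forall>c. \<forall>f\<in>cont_space K. \<phi> (\<lambda>x\<in>topspace K. c * f x) = c * \<phi> f) \<and>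
      (\<forall>f\<in>cont_space K. (\<forall>x\<in>topspace K. norm (f x) \<le> 1) \<longrightarrow> norm (\<phi> f) \<le> 1)}"

text \<open>The weak-star topology is the topology of pointwise convergence on \<open>C(K)\<close>.\<close>

definition weak_star_unit_ball ::
    "'a topology \<Rightarrow> (('a \<Rightarrow> 'k::real_normed_field) \<Rightarrow> 'k) topology"
  where "weak_star_unit_ball K =
    subtopology (product_topology (\<lambda>_. euclidean) (cont_space K)) (dual_unit_ball K)"

definition approximable :: "'k::real_normed_field itself \<Rightarrow> 'a topology \<Rightarrow> bool"
  where "approximable _ K \<longleftrightarrow>
    separable_space (weak_star_unit_ball K :: (('a \<Rightarrow> 'k) \<Rightarrow> 'k) topology)"

section \<open>Complemented subspaces of \<open>\<ell>\<^sub>\<infinity>\<close>\<close>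

text \<open>As \<^typ>\<open>nat\<close> is discrete, bounded continuous functions on it are bounded sequences.\<close>

type_synonym 'k linfty = "nat \<Rightarrow>\<^sub>C 'k"

definition linfty_scale :: "'k::real_normed_field \<Rightarrow> 'k linfty \<Rightarrow> 'k linfty"
  where "linfty_scale c x = Bcontfun (\<lambda>n. c * apply_bcontfun x n)"

lemma apply_linfty_scale [simp]:
  "apply_bcontfun (linfty_scale c x) n = c * apply_bcontfun x n"
proof -
  have "bounded ((\<lambda>y. c * y) ` range (apply_bcontfun x))"
    by (intro bounded_linear_image bounded_apply_bcontfun bounded_linear_mult_right)
  then have "(\<lambda>n. c * apply_bcontfun x n) \<in> bcontfun"
    by (auto simp: bcontfun_def image_image)
  then show ?thesis
    by (simp add: linfty_scale_def Bcontfun_inverse)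
qed

definition c0_ideal :: "nat set set \<Rightarrow> 'k::real_normed_field linfty set"
  where "c0_ideal I = {x. \<forall>\<epsilon>>0. {n. norm (apply_bcontfun x n) \<ge> \<epsilon>} \<in> I}"

text \<open>
  \<^const>\<open>bounded_linear\<close> only gives linearity over the reals; homogeneity over \<open>'k\<close> is required
  separately.
\<close>

definition complemented :: "'k::real_normed_field linfty set \<Rightarrow> bool"
  where "complemented S \<longleftrightarrow>
    (\<exists>P. bounded_linear P \<and> (\<forall>c x. P (linfty_scale c x) = linfty_scale c (P x)) \<and>
      P \<circ> P = P \<and> range P = S)"

end

theory Submission
  imports Defs
begin

text \<open>
  Both statements reduce to one: no sequence of bounded functionals on bounded sequences that
  vanish on \<open>c\<^sub>0\<^sub>,\<^sub>\<I>\<close> separates the points modulo \<open>c\<^sub>0\<^sub>,\<^sub>\<I>\<close>. A projection \<open>P\<close> onto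
  \<open>c\<^sub>0\<^sub>,\<^sub>\<I>\<close> would give the separating functionals \<open>x \<mapsto> (x - P x)\<^sub>n\<close>, and a weak-star dense
  sequence in the dual ball of \<open>C(K)\<close> would give separating functionals after composition with
  \<open>x \<mapsto> (p \<mapsto> p-lim x)\<close>.

  Along a sparse set the density is, in the limit, a uniform measure on blocks, so countable
  unions of small sets are small modulo null sets. As in the Yosida-Hewitt decomposition, this
  yields a set \<open>A\<close> of density close to 1 on which every functional of the sequence is absolutely
  continuous with respect to the density. On \<open>A\<close> each functional annihilates all but countably
  many of the sequences \<open>cos (a i)\<close> with \<open>0 < a < \<pi>\<close>, since these are orthogonal in mean. Hence some
  \<open>cos (a i)\<close> restricted to \<open>A\<close> is annihilated by all functionals, but it is not in \<open>c\<^sub>0\<^sub>,\<^sub>\<I>\<close>.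
\<close>

section \<open>Ultrafilter limits and densities\<close>

lemma ultrafilterD_neq_bot: "ultrafilter p \<Longrightarrow> p \<noteq> bot"
  by (simp add: ultrafilter_def)

lemma eventually_ultrafilter_not_iff:
  assumes "ultrafilter p"
  shows "(\<forall>\<^sub>F x in p. \<not> P x) \<longleftrightarrow> \<not> (\<forall>\<^sub>F x in p. P x)"
proof
  assume *: "\<forall>\<^sub>F x in p. \<not> P x"
  show "\<not> (\<forall>\<^sub>F x in p. P x)"
  proof
    assume "\<forall>\<^sub>F x in p. P x"
    with * have "\<forall>\<^sub>F x in p. False"
      by eventually_elim simp
    with assms show False
      by (simp add: ultrafilter_def eventually_False)
  qed
qed (use assms in \<open>auto simp: ultrafilter_def\<close>)

lemma ultrafilter_principal_singleton: "ultrafilter (principal {a})"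
  unfolding ultrafilter_def
  by (metis eventually_principal insert_not_empty principal_eq_bot_iff singletonD)

text \<open>Zorn's lemma on the proper filters below \<open>F\<close>, ordered so that smaller
  filters, which have more eventual properties, come later. A minimal proper filter must decide
  every \<open>P\<close>.\<close>

lemma ex_ultrafilter_le:
  assumes "F \<noteq> bot"
  obtains p where "ultrafilter p" "p \<le> F"
proof -
  let ?A = "{G. G \<le> F \<and> G \<noteq> bot}"
  let ?r = "relation_of (\<lambda>x y. y \<le> x) ?A"
  have po': "partial_order_on ?A ?r"
    by (rule partial_order_on_relation_ofI) auto
  have field: "Field ?r = ?A"
    using po' by (intro Field_relation_of) (auto simp: partial_order_on_def preorder_on_def)
  then have po: "Partial_order ?r"
    using po' by simp
  have "\<exists>m\<in>Field ?r. \<forall>a\<in>Field ?r. (m, a) \<in> ?r \<longrightarrow> a = m"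
  proof (rule Zorns_po_lemma[OF po])
    fix C assume C: "C \<in> Chains ?r"
    show "\<exists>u\<in>Field ?r. \<forall>a\<in>C. (a, u) \<in> ?r"
    proof (cases "C = {}")
      case True
      then show ?thesis
        using assms unfolding field by blast
    next
      case False
      have CA: "C \<subseteq> ?A"
        using C by (auto simp: Chains_def relation_of_def)
      have dir: "\<exists>x\<in>C. x \<le> inf G H" if "G \<in> C" "H \<in> C" for G H
      proof -
        have "G \<le> H \<or> H \<le> G"
          using C that by (auto simp: Chains_def relation_of_def)
        with that show ?thesis by (metis inf.absorb1 inf.absorb2 order_refl)
      qed
      \<comment> \<open>A chain is directed, so a property eventual for \<open>Inf C\<close> is
        already eventual for one member; \<open>False\<close> would make that member
        improper.\<close>
      have nb: "Inf C \<noteq> bot"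
      proof
        assume "Inf C = bot"
        then have "eventually (\<lambda>_. False) (Inf C)"
          by simp
        then obtain G where "G \<in> C" "eventually (\<lambda>_. False) G"
          using eventually_Inf_base[OF False dir] by blast
        with CA show False
          by (auto simp: eventually_False)
      qed
      moreover have "Inf C \<le> F"
        using False CA by (metis (mono_tags, lifting) Inf_lower2 mem_Collect_eq subset_iff ex_in_conv)
      ultimately have "Inf C \<in> ?A" by simp
      moreover have "\<forall>a\<in>C. (a, Inf C) \<in> ?r"
        using CA calculation by (auto simp: relation_of_def Inf_lower)
      ultimately show ?thesis
        unfolding field by blast
    qed
  qed
  then obtain p where p: "p \<in> ?A" and max: "\<And>G. G \<in> ?A \<Longrightarrow> G \<le> p \<Longrightarrow> G = p"
    unfolding field by (auto simp: relation_of_def)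
  have "ultrafilter p"
    unfolding ultrafilter_def
  proof (intro conjI allI)
    show "p \<noteq> bot" using p by simp
    fix P
    show "(\<forall>\<^sub>F x in p. P x) \<or> (\<forall>\<^sub>F x in p. \<not> P x)"
    proof (rule disjCI)
      \<comment> \<open>If the negation of \<open>P\<close> is not eventual, adjoining
        \<open>P\<close> keeps the filter proper, and minimality says that nothing was
        added.\<close>
      assume "\<not> (\<forall>\<^sub>F x in p. \<not> P x)"
      then have "inf p (principal {x. P x}) \<noteq> bot"
        by (auto simp: trivial_limit_def eventually_inf_principal)
      then have "inf p (principal {x. P x}) = p"
        using p by (intro max) (auto intro: le_infI1)
      then have "p \<le> principal {x. P x}"
        by (metis inf.cobounded2)
      then show "\<forall>\<^sub>F x in p. P x"
        by (auto simp: le_principal)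
    qed
  qed
  with p show thesis
    using that by blast
qed

text \<open>The image filter lives on the compact closure of the range and so has a cluster point;
  for an ultrafilter every cluster point is a limit.\<close>

lemma ultrafilter_tendsto_Lim:
  fixes x :: "'a \<Rightarrow> 'b::heine_borel"
  assumes p: "ultrafilter p" and x: "bounded (range x)"
  shows "(x \<longlongrightarrow> Lim p x) p"
proof -
  have "compact (closure (range x))"
    using x by simp
  moreover have "filtermap x p \<noteq> bot"
    using ultrafilterD_neq_bot[OF p] by (simp add: filtermap_bot_iff)
  moreover have "eventually (\<lambda>y. y \<in> closure (range x)) (filtermap x p)"
    by (simp add: eventually_filtermap closure_subset[THEN subsetD])
  ultimately obtain l where l: "inf (nhds l) (filtermap x p) \<noteq> bot"
    unfolding compact_filter by blast
  have "(x \<longlongrightarrow> l) p"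
  proof (rule topological_tendstoI, rule ccontr)
    fix S assume S: "open S" "l \<in> S" and "\<not> (\<forall>\<^sub>F i in p. x i \<in> S)"
    then have "\<forall>\<^sub>F i in p. x i \<notin> S"
      using eventually_ultrafilter_not_iff[OF p, of "\<lambda>i. x i \<in> S"] by blast
    then have "\<forall>\<^sub>F y in filtermap x p. y \<notin> S"
      by (simp add: eventually_filtermap)
    moreover have "\<forall>\<^sub>F y in nhds l. y \<in> S"
      using S by (rule eventually_nhds_in_open)
    ultimately have "\<forall>\<^sub>F y in inf (nhds l) (filtermap x p). False"
      unfolding eventually_inf by blast
    with l show False
      by (simp add: eventually_False)
  qed
  with tendsto_Lim[OF ultrafilterD_neq_bot[OF p]] show ?thesis
    by metis
qed

text \<open>Freeness excludes each initial segment, being finite. Ordinary limits of sequences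
  thereby pass to \<open>U\<close>.\<close>

lemma free_ultrafilter_le_sequentially:
  fixes U :: "nat filter"
  assumes "free_ultrafilter U"
  shows "U \<le> sequentially"
proof -
  have "eventually P U" if "eventually P sequentially" for P
  proof -
    obtain N where N: "\<And>n. n \<ge> N \<Longrightarrow> P n"
      using \<open>eventually P sequentially\<close> by (auto simp: eventually_sequentially)
    have "\<forall>\<^sub>F n in U. \<forall>a\<in>{..<N}. n \<noteq> a"
      using assms by (intro eventually_ball_finite) (auto simp: free_ultrafilter_def)
    then show ?thesis
      by eventually_elim (use N in \<open>auto simp: not_less[symmetric]\<close>)
  qed
  then show ?thesis
    by (auto simp: le_filter_def)
qed

section \<open>Relative frequencies and the density as their limit\<close>

definition rel_freq :: "nat set \<Rightarrow> nat \<Rightarrow> real"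
  where "rel_freq A n = real (card (A \<inter> {..<n})) / real n"

lemma rel_freq_nonneg: "0 \<le> rel_freq A n"
  by (simp add: rel_freq_def)

lemma rel_freq_le_1: "rel_freq A n \<le> 1"
proof -
  have "card (A \<inter> {..<n}) \<le> n"
    by (metis Int_lower2 card_lessThan card_mono finite_lessThan)
  then show ?thesis
    by (auto simp: rel_freq_def divide_le_eq)
qed

lemma rel_freq_mono: "A \<subseteq> B \<Longrightarrow> rel_freq A n \<le> rel_freq B n"
  unfolding rel_freq_def
  by (intro divide_right_mono of_nat_mono card_mono) auto

lemma rel_freq_Un_le: "rel_freq (A \<union> B) n \<le> rel_freq A n + rel_freq B n"
proof -
  have "card ((A \<union> B) \<inter> {..<n}) \<le> card (A \<inter> {..<n}) + card (B \<inter> {..<n})"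
    by (simp add: Int_Un_distrib2 card_Un_le)
  then show ?thesis
    by (simp add: rel_freq_def flip: add_divide_distrib of_nat_add)
       (simp add: divide_right_mono)
qed

lemma rel_freq_Un_disjoint:
  "A \<inter> B = {} \<Longrightarrow> rel_freq (A \<union> B) n = rel_freq A n + rel_freq B n"
proof -
  assume "A \<inter> B = {}"
  then have "card ((A \<union> B) \<inter> {..<n}) = card (A \<inter> {..<n}) + card (B \<inter> {..<n})"
    unfolding Int_Un_distrib2 by (intro card_Un_disjoint) auto
  then show ?thesis
    by (simp add: rel_freq_def add_divide_distrib)
qed

lemma density_eq_Lim_rel_freq: "density U A = Lim U (rel_freq A)"
  by (simp add: density_def rel_freq_def[abs_def])

context
  fixes U :: "nat filter"
  assumes U: "free_ultrafilter U"
begin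

lemma tendsto_density: "(rel_freq A \<longlongrightarrow> density U A) U"
proof -
  have "bounded (range (rel_freq A))"
    by (auto intro!: boundedI[of _ 1] simp: rel_freq_nonneg rel_freq_le_1)
  then show ?thesis
    using U by (simp add: ultrafilter_tendsto_Lim free_ultrafilter_def density_eq_Lim_rel_freq)
qed

lemma free_ultrafilter_neq_bot: "U \<noteq> bot"
  using U by (simp add: free_ultrafilter_def ultrafilter_def)

lemma density_eqI: "(rel_freq A \<longlongrightarrow> c) U \<Longrightarrow> density U A = c"
  by (simp add: density_eq_Lim_rel_freq free_ultrafilter_neq_bot tendsto_Lim)

lemma density_leI: "(\<forall>\<^sub>F n in U. rel_freq A n \<le> c) \<Longrightarrow> density U A \<le> c"
  using tendsto_density free_ultrafilter_neq_bot tendsto_upperbound by blast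

lemma density_nonneg: "0 \<le> density U A"
  using tendsto_lowerbound[OF tendsto_density _ free_ultrafilter_neq_bot]
  by (simp add: rel_freq_nonneg)

lemma density_mono: "A \<subseteq> B \<Longrightarrow> density U A \<le> density U B"
  by (intro tendsto_le[OF free_ultrafilter_neq_bot tendsto_density tendsto_density])
     (simp add: rel_freq_mono)

lemma density_Un_le: "density U (A \<union> B) \<le> density U A + density U B"
  by (intro tendsto_le[OF free_ultrafilter_neq_bot tendsto_add[OF tendsto_density tendsto_density]
        tendsto_density])
     (simp add: rel_freq_Un_le)

lemma density_Un_disjoint:
  assumes "A \<inter> B = {}"
  shows "density U (A \<union> B) = density U A + density U B"
proof (rule density_eqI)
  have "rel_freq (A \<union> B) = (\<lambda>n. rel_freq A n + rel_freq B n)"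
    using rel_freq_Un_disjoint[OF assms] by blast
  then show "(rel_freq (A \<union> B) \<longlongrightarrow> density U A + density U B) U"
    using tendsto_add[OF tendsto_density tendsto_density] by simp
qed

lemma density_empty: "density U {} = 0"
  by (intro density_eqI) (simp add: rel_freq_def[abs_def])

lemma density_UNIV: "density U UNIV = 1"
proof (rule density_eqI)
  \<comment> \<open>At \<open>n = 0\<close> the quotient is 0, not 1, because division by zero gives
    0; freeness discards this point.\<close>
  have "\<forall>\<^sub>F n in U. n \<noteq> 0"
    using U unfolding free_ultrafilter_def by blast
  then have "\<forall>\<^sub>F n in U. rel_freq UNIV n = 1"
    by eventually_elim (simp add: rel_freq_def)
  then show "(rel_freq UNIV \<longlongrightarrow> 1) U"
    by (rule tendsto_eventually)
qed

lemma density_null_subset: "A \<subseteq> B \<Longrightarrow> density U B = 0 \<Longrightarrow> density U A = 0"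
  using density_mono[of A B] density_nonneg[of A] by linarith

lemma density_UN_lessThan_le: "density U (\<Union>i<(m::nat). B i) \<le> (\<Sum>i<m. density U (B i))"
proof (induction m)
  case (Suc m)
  then show ?case
    using density_Un_le[of "B m" "\<Union>i<m. B i"] by (simp add: lessThan_Suc)
qed (simp add: density_empty)

end

section \<open>A countable-union property of densities along sparse sets\<close>

text \<open>Since \<open>U\<close> contains \<open>range t\<close> and goes to infinity, densities
  are computed at right end points of late blocks, where everything below \<open>t j\<close> has
  frequency less than \<open>e\<close>. Only the last block then counts.\<close>

lemma sparse_eventually_block:
  fixes t :: "nat \<Rightarrow> nat"
  assumes t: "strict_mono t"
    and sparse: "(\<lambda>j. real (t j) / real (t (Suc j))) \<longlonglongrightarrow> 0"
    and U: "free_ultrafilter U" and T: "\<forall>\<^sub>F n in U. n \<in> range t" and e: "0 < e"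
  shows "\<forall>\<^sub>F n in U. \<exists>j\<ge>k. n = t (Suc j) \<and> real (t j) / real n < e"
proof -
  obtain J where J: "\<And>j. j \<ge> J \<Longrightarrow> real (t j) / real (t (Suc j)) < e"
    using order_tendstoD(2)[OF sparse e] by (auto simp: eventually_sequentially)
  have "\<forall>\<^sub>F n in U. n > t (max J k)"
    using filter_leD[OF free_ultrafilter_le_sequentially[OF U] eventually_gt_at_top] .
  with T show ?thesis
  proof eventually_elim
    case (elim n)
    then obtain i where i: "n = t i" "i > max J k"
      using strict_mono_less[OF t] by auto
    \<comment> \<open>The strict bound on \<open>i\<close> leaves room for its predecessor
      \<open>j\<close>, which is still at least \<open>J\<close> and \<open>k\<close>.\<close>
    then obtain j where "i = Suc j"
      using not0_implies_Suc by (metis not_less_zero)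
    with i J show ?case
      by (intro exI[of _ j]) auto
  qed
qed

text \<open>The set \<open>C\<close> copies, on the block \<open>[t\<^sub>j, t\<^sub>j\<^sub>+\<^sub>1)\<close>, a finite union of the \<open>B\<^sub>i\<close> whose length
  grows slowly enough with \<open>j\<close>; by sparseness the earlier blocks do not affect \<open>rel_freq\<close> at
  \<open>t\<^sub>j\<^sub>+\<^sub>1\<close>.\<close>

lemma sparse_density_pseudo_union:
  fixes t :: "nat \<Rightarrow> nat" and B :: "nat \<Rightarrow> nat set"
  assumes t: "strict_mono t"
    and sparse: "(\<lambda>j. real (t j) / real (t (Suc j))) \<longlonglongrightarrow> 0"
    and U: "free_ultrafilter U" and T: "\<forall>\<^sub>F n in U. n \<in> range t"
    and le: "\<And>m. (\<Sum>i<m. density U (B i)) \<le> e" and e: "e < e'"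
  obtains C where "density U C \<le> e'" "\<And>k. density U (B k - C) = 0"
proof -
  define G where "G m = (\<Union>i<m. B i)" for m
  \<comment> \<open>Admissible lengths of the union on block \<open>j\<close>. The cap
    \<open>m \<le> j\<close> keeps this set finite, so that a largest length exists, and still lets
    it grow with \<open>j\<close>.\<close>
  define N where "N j = {m. m \<le> j \<and> rel_freq (G m) (t (Suc j)) \<le> e'}" for j
  define \<kappa> where "\<kappa> j = Max (N j)" for j
  define C where "C = {i. \<exists>j. t j \<le> i \<and> i < t (Suc j) \<and> i \<in> G (\<kappa> j)}"
  note block = sparse_eventually_block[OF t sparse U T]
  have "0 \<le> e"
    using le[of 0] by simp
  have fin: "finite (N j)" for j
    by (simp add: N_def)
  \<comment> \<open>The empty union is always admissible, so the maximum is taken over a nonempty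
    set.\<close>
  have "0 \<in> N j" for j
    using \<open>0 \<le> e\<close> e by (simp add: N_def G_def rel_freq_def)
  then have \<kappa>: "\<kappa> j \<in> N j" for j
    unfolding \<kappa>_def using fin Max_in by blast
  have C_le: "density U C \<le> e' + d" if "d > 0" for d
  proof (rule density_leI[OF U])
    show "\<forall>\<^sub>F n in U. rel_freq C n \<le> e' + d"
      using block[OF that, of 0]
    proof eventually_elim
      case (elim n)
      then obtain j where j: "n = t (Suc j)" "real (t j) / real n < d"
        by auto
      \<comment> \<open>Blocks are disjoint: below \<open>t (Suc j)\<close> an element of
        \<open>C\<close> either precedes the last block or was selected in it.\<close>
      have "i \<in> {..<t j} \<union> G (\<kappa> j)" if "i \<in> C" "i < n" for i
      proof (rule ccontr)
        assume "i \<notin> {..<t j} \<union> G (\<kappa> j)"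
        with that j obtain k where "t k \<le> i" "i < t (Suc k)" "t j \<le> i" "i < t (Suc j)" "k \<noteq> j"
          by (auto simp: C_def not_less)
        then have "t k < t (Suc j)" "t j < t (Suc k)" "k \<noteq> j" by linarith+
        then show False
          by (simp add: strict_mono_less[OF t])
      qed
      then have "C \<inter> {..<n} \<subseteq> ({..<t j} \<union> G (\<kappa> j)) \<inter> {..<n}" by auto
      then have "rel_freq C n \<le> rel_freq ({..<t j} \<union> G (\<kappa> j)) n"
        unfolding rel_freq_def by (intro divide_right_mono of_nat_mono card_mono) auto
      also have "\<dots> \<le> rel_freq {..<t j} n + rel_freq (G (\<kappa> j)) n"
        by (rule rel_freq_Un_le)
      also have "rel_freq (G (\<kappa> j)) n \<le> e'"
        using \<kappa>[of j] j by (simp add: N_def)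
      also have "rel_freq {..<t j} n \<le> real (t j) / real n"
        unfolding rel_freq_def
        by (intro divide_right_mono of_nat_mono) (auto intro: order.trans[OF card_mono[of "{..<t j}"]])
      finally show ?case
        using j by linarith
    qed
  qed
  have B_le: "density U (B k - C) \<le> d" if "d > 0" for k d
  proof (rule density_leI[OF U])
    have "density U (G (Suc k)) \<le> e"
      using density_UN_lessThan_le[OF U] le order.trans unfolding G_def by blast
    \<comment> \<open>The gap between \<open>e\<close> and \<open>e'\<close> turns the bound on the
      density into a bound on the frequency at \<open>U\<close>-almost every
      \<open>n\<close>.\<close>
    then have "\<forall>\<^sub>F n in U. rel_freq (G (Suc k)) n < e'"
      using e order_tendstoD(2)[OF tendsto_density[OF U]] by (meson le_less_trans)
    then show "\<forall>\<^sub>F n in U. rel_freq (B k - C) n \<le> d"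
      using block[OF that, of "Suc k"]
    proof eventually_elim
      case (elim n)
      then obtain j where j: "n = t (Suc j)" "Suc k \<le> j" "real (t j) / real n < d"
        by auto
      \<comment> \<open>\<open>G (Suc k)\<close> is the first partial union containing
        \<open>B k\<close>. Once its length is admissible, block \<open>j\<close> copies all of
        \<open>B k\<close>, and below \<open>n\<close> the rest \<open>B k - C\<close> can only meet
        the part before \<open>t j\<close>.\<close>
      then have "Suc k \<in> N j"
        using elim by (simp add: N_def)
      then have "Suc k \<le> \<kappa> j"
        unfolding \<kappa>_def using fin by simp
      then have "B k \<subseteq> G (\<kappa> j)"
        unfolding G_def by (intro UN_upper) simp
      then have "(B k - C) \<inter> {..<n} \<subseteq> {..<t j}"
        using j by (auto simp: C_def not_le[symmetric])
      then have "card ((B k - C) \<inter> {..<n}) \<le> t j"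
        using card_mono[of "{..<t j}"] by fastforce
      then have "rel_freq (B k - C) n \<le> real (t j) / real n"
        unfolding rel_freq_def by (intro divide_right_mono) auto
      with j show ?case by linarith
    qed
  qed
  show thesis
  proof
    show "density U C \<le> e'"
      using C_le field_le_epsilon by blast
    show "density U (B k - C) = 0" for k
      using B_le[of _ k] density_nonneg[OF U, of "B k - C"] field_le_epsilon[of "density U (B k - C)" 0]
      by force
  qed
qed

section \<open>Orthogonality of cosines\<close>

text \<open>The factor \<open>2 * sin (\<theta> / 2)\<close> makes the sum telescope into a
  difference of two sines, as for the Dirichlet kernel.\<close>

lemma sum_cos_bounded:
  "\<bar>2 * sin (\<theta> / 2) * (\<Sum>i<n. cos (\<theta> * real i))\<bar> \<le> 2"
proof -
  have "2 * sin (\<theta> / 2) * (\<Sum>i<n. cos (\<theta> * real i)) = sin (\<theta> * (real n - 1 / 2)) + sin (\<theta> / 2)"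
  proof (induction n)
    case (Suc n)
    have "2 * sin (\<theta> / 2) * cos (\<theta> * real n) =
        sin (\<theta> * (real n + 1 / 2)) - sin (\<theta> * (real n - 1 / 2))"
      using sin_diff_sin[of "\<theta> * (real n + 1 / 2)" "\<theta> * (real n - 1 / 2)"]
      by (simp add: field_simps)
    with Suc show ?case
      by (simp add: algebra_simps)
  qed simp
  also have "\<bar>\<dots>\<bar> \<le> \<bar>sin (\<theta> * (real n - 1 / 2))\<bar> + \<bar>sin (\<theta> / 2)\<bar>"
    by (rule abs_triangle_ineq)
  also have "\<dots> \<le> 2"
    using abs_sin_le_one[of "\<theta> * (real n - 1 / 2)"] abs_sin_le_one[of "\<theta> / 2"] by linarith
  finally show ?thesis .
qed

lemma mean_cos_tendsto_0:
  assumes "sin (\<theta> / 2) \<noteq> 0"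
  shows "(\<lambda>n. (\<Sum>i<n. cos (\<theta> * real i)) / real n) \<longlonglongrightarrow> 0"
proof (rule Lim_null_comparison)
  let ?K = "1 / \<bar>sin (\<theta> / 2)\<bar>"
  have "\<bar>\<Sum>i<n. cos (\<theta> * real i)\<bar> \<le> ?K" for n
    using sum_cos_bounded[of \<theta> n] assms by (simp add: abs_mult field_simps)
  then show "\<forall>\<^sub>F n in sequentially. norm ((\<Sum>i<n. cos (\<theta> * real i)) / real n) \<le> ?K / real n"
    by (intro always_eventually allI) (simp add: divide_right_mono del: divide_divide_eq_left)
  show "(\<lambda>n. ?K / real n) \<longlonglongrightarrow> 0"
    by (rule lim_const_over_n)
qed

text \<open>The product is half the sum of cosines of frequencies \<open>a - b\<close> and
  \<open>a + b\<close>. Both halved frequencies stay strictly between \<open>- pi\<close> and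
  \<open>pi\<close>, so their sines vanish only for \<open>a = b\<close>, where the difference term
  has mean 1.\<close>

lemma mean_cos_mult_cos_tendsto:
  assumes "a \<in> {0<..<pi}" "b \<in> {0<..<pi}"
  shows "(\<lambda>n. (\<Sum>i<n. cos (a * real i) * cos (b * real i)) / real n) \<longlonglongrightarrow>
    (if a = b then 1 / 2 else 0)"
proof -
  have eq: "(\<Sum>i<n. cos (a * real i) * cos (b * real i)) / real n =
      1 / 2 * ((\<Sum>i<n. cos ((a - b) * real i)) / real n) +
      1 / 2 * ((\<Sum>i<n. cos ((a + b) * real i)) / real n)" for n
    by (simp add: cos_times_cos left_diff_distrib distrib_right add_divide_distrib
        sum.distrib sum_divide_distrib mult.commute[of 2])
  have "0 < sin ((a + b) / 2)"
    using assms by (intro sin_gt_zero) auto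
  then have plus: "(\<lambda>n. (\<Sum>i<n. cos ((a + b) * real i)) / real n) \<longlonglongrightarrow> 0"
    by (intro mean_cos_tendsto_0) simp
  have minus: "(\<lambda>n. (\<Sum>i<n. cos ((a - b) * real i)) / real n) \<longlonglongrightarrow> (if a = b then 1 else 0)"
  proof (cases "a = b")
    case True
    have "\<forall>\<^sub>F n in sequentially. (\<Sum>i<n. cos ((a - b) * real i)) / real n = 1"
      using eventually_gt_at_top[of 0] by eventually_elim (simp add: True)
    then show ?thesis
      using True by (simp add: tendsto_eventually)
  next
    case False
    have "sin ((a - b) / 2) \<noteq> 0"
    proof (cases "a < b")
      case True
      then have "0 < sin ((b - a) / 2)"
        using assms by (intro sin_gt_zero) auto
      then show ?thesis
        by (metis minus_diff_eq minus_divide_left neg_0_equal_iff_equal less_irrefl sin_minus)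
    next
      case False
      with \<open>a \<noteq> b\<close> have "0 < sin ((a - b) / 2)"
        using assms by (intro sin_gt_zero) auto
      then show ?thesis by simp
    qed
    then show ?thesis
      using False by (simp add: mean_cos_tendsto_0)
  qed
  show ?thesis
    unfolding eq
    by (rule tendsto_eq_rhs[OF tendsto_add[OF tendsto_mult_left[OF minus] tendsto_mult_left[OF plus]]])
       simp
qed

text \<open>Pythagoras in the mean: when the square is expanded, the cross terms average to 0 and
  each diagonal term to 1/2, whatever the unit vectors are.\<close>

lemma mean_norm_sum_cos_tendsto:
  fixes v :: "real \<Rightarrow> 'b::real_inner"
  assumes F: "finite F" "F \<subseteq> {0<..<pi}" and v: "\<And>a. a \<in> F \<Longrightarrow> norm (v a) = 1"
  shows "(\<lambda>n. (\<Sum>i<n. (norm (\<Sum>a\<in>F. cos (a * real i) *\<^sub>R v a))\<^sup>2) / real n) \<longlonglongrightarrow> real (card F) / 2"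
proof -
  have eq: "(\<Sum>i<n. (norm (\<Sum>a\<in>F. cos (a * real i) *\<^sub>R v a))\<^sup>2) / real n =
     (\<Sum>a\<in>F. \<Sum>b\<in>F. (v a \<bullet> v b) * ((\<Sum>i<n. cos (a * real i) * cos (b * real i)) / real n))" for n
  proof -
    have "(\<Sum>i<n. (norm (\<Sum>a\<in>F. cos (a * real i) *\<^sub>R v a))\<^sup>2) =
        (\<Sum>i<n. \<Sum>a\<in>F. \<Sum>b\<in>F. (v a \<bullet> v b) * (cos (a * real i) * cos (b * real i)))"
      by (simp add: power2_norm_eq_inner inner_sum_left inner_sum_right sum_distrib_left mult_ac inner_commute)
    also have "\<dots> = (\<Sum>a\<in>F. \<Sum>b\<in>F. (v a \<bullet> v b) * (\<Sum>i<n. cos (a * real i) * cos (b * real i)))"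
      by (subst sum.swap, rule sum.cong[OF refl], subst sum.swap) (simp add: sum_distrib_left)
    finally show ?thesis
      by (simp add: sum_divide_distrib sum_distrib_left)
  qed
  have "(\<lambda>n. \<Sum>a\<in>F. \<Sum>b\<in>F. (v a \<bullet> v b) * ((\<Sum>i<n. cos (a * real i) * cos (b * real i)) / real n))
      \<longlonglongrightarrow> (\<Sum>a\<in>F. \<Sum>b\<in>F. (v a \<bullet> v b) * (if a = b then 1 / 2 else 0))"
    using F by (intro tendsto_sum tendsto_mult_left mean_cos_mult_cos_tendsto) auto
  also have "(\<Sum>a\<in>F. \<Sum>b\<in>F. (v a \<bullet> v b) * (if a = b then 1 / 2 else 0)) = (\<Sum>a\<in>F. 1 / 2)"
    using F v by (intro sum.cong refl) (simp add: if_distrib dot_square_norm cong: if_cong)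
  finally show ?thesis
    unfolding eq by simp
qed

section \<open>Functionals vanishing on null sequences\<close>

text \<open>Supplies the rotations that turn values into nonnegative reals, so that norms of values
  can be added without cancellation.\<close>

lemma ex_unit_mult_eq_norm:
  fixes z :: "'k::real_normed_field"
  obtains u where "norm u = 1" "u * z = of_real (norm z)"
proof (cases "z = 0")
  case True
  with that[of 1] show ?thesis by simp
next
  case False
  with that[of "of_real (norm z) / z"] show ?thesis by (simp add: norm_divide)
qed

text \<open>Test functions for absolute continuity with respect to the density: a functional is
  absolutely continuous when it is small on them for small \<open>\<zeta>\<close>.\<close>

definition small_supported :: "nat filter \<Rightarrow> real \<Rightarrow> (nat \<Rightarrow> 'k::real_normed_vector) set"
  where "small_supported U \<zeta> = {x. (\<forall>i. norm (x i) \<le> 1) \<and> density U {i. x i \<noteq> 0} \<le> \<zeta>}"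

text \<open>Common form of the two sources of functionals: coordinates of \<open>x - P x\<close>,
  and functionals on the continuous functions on the support composed with ultrafilter limits.
  \<open>\<phi>\<close> is a total function, hence the boundedness premises. The inner product on
  the scalars serves the mean-square estimate.\<close>

locale null_functional =
  fixes U :: "nat filter"
    and \<phi> :: "(nat \<Rightarrow> 'k::{real_normed_field,real_inner}) \<Rightarrow> 'k" and L :: real
  assumes U: "free_ultrafilter U"
    and add: "bounded (range x) \<Longrightarrow> bounded (range y) \<Longrightarrow> \<phi> (\<lambda>i. x i + y i) = \<phi> x + \<phi> y"
    and scale: "bounded (range x) \<Longrightarrow> \<phi> (\<lambda>i. c * x i) = c * \<phi> x"
    and bound: "(\<And>i. norm (x i) \<le> 1) \<Longrightarrow> norm (\<phi> x) \<le> L"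
    and null: "bounded (range x) \<Longrightarrow>
      (\<And>e. 0 < e \<Longrightarrow> density U {i. e \<le> norm (x i)} = 0) \<Longrightarrow> \<phi> x = 0"
begin

lemma zero: "\<phi> (\<lambda>_. 0) = 0"
  by (rule null) (auto simp: density_empty[OF U])

lemma L_nonneg: "0 \<le> L"
  using bound[of "\<lambda>_. 0"] by (simp add: zero)

lemma bound_scaled:
  assumes "\<And>i. norm (x i) \<le> \<eta>" "0 < \<eta>"
  shows "norm (\<phi> x) \<le> L * \<eta>"
proof -
  let ?y = "\<lambda>i. of_real (inverse \<eta>) * x i"
  have y: "norm (?y i) \<le> 1" for i
    using assms(1)[of i] assms(2) by (simp add: norm_mult norm_divide del: of_real_inverse) (simp add: field_simps)
  have "\<phi> x = \<phi> (\<lambda>i. of_real \<eta> * ?y i)"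
    using assms by (intro arg_cong[of _ _ \<phi>] ext) (simp flip: of_real_mult mult.assoc)
  also have "\<dots> = of_real \<eta> * \<phi> ?y"
    using y by (intro scale boundedI[of _ 1]) auto
  finally show ?thesis
    using assms bound[of ?y] y by (simp add: norm_mult mult.commute)
qed

lemma null_support:
  assumes "bounded (range x)" "density U {i. x i \<noteq> 0} = 0"
  shows "\<phi> x = 0"
  by (rule null[OF assms(1)], rule density_null_subset[OF U _ assms(2)]) auto

text \<open>Boundedness of the partial sums is carried through the induction because
  \<open>add\<close> asks for it at each step.\<close>

lemma sum:
  assumes "finite F" "\<And>a. a \<in> F \<Longrightarrow> bounded (range (x a))"
  shows "\<phi> (\<lambda>i. \<Sum>a\<in>F. x a i) = (\<Sum>a\<in>F. \<phi> (x a)) \<and> bounded (range (\<lambda>i. \<Sum>a\<in>F. x a i))"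
  using assms
proof (induction F rule: finite_induct)
  case (insert a F)
  then have "bounded (range (\<lambda>i. x a i + (\<Sum>a\<in>F. x a i)))"
    by (intro bounded_plus_comp) auto
  with insert show ?case
    by (simp add: add)
qed (simp add: zero)

text \<open>The mass of the purely finitely additive part of \<open>\<phi>\<close> relative to the density.\<close>

definition singular_mass :: real
  where "singular_mass = (INF \<zeta>\<in>{0<..}. SUP x\<in>small_supported U \<zeta>. norm (\<phi> x))"

lemma bdd_above_small_supported: "bdd_above ((\<lambda>x. norm (\<phi> x)) ` small_supported U \<zeta>)"
  by (intro bdd_aboveI2[of _ _ L] bound) (auto simp: small_supported_def)

lemma zero_in_small_supported: "0 \<le> \<zeta> \<Longrightarrow> (\<lambda>_. 0) \<in> small_supported U \<zeta>"
  by (simp add: small_supported_def density_empty[OF U])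

lemma bdd_below_sup_small_supported:
  "bdd_below ((\<lambda>\<zeta>. SUP x\<in>small_supported U \<zeta>. norm (\<phi> x)) ` {0<..})"
proof (rule bdd_belowI2[of _ 0])
  fix \<zeta> :: real assume "\<zeta> \<in> {0<..}"
  then show "0 \<le> (SUP x\<in>small_supported U \<zeta>. norm (\<phi> x))"
    by (intro cSUP_upper2[OF bdd_above_small_supported zero_in_small_supported]) auto
qed

text \<open>The infimum lies below the supremum for each single \<open>\<zeta>\<close>, so functions
  of arbitrarily small support nearly attain the mass.\<close>

lemma singular_mass_approx:
  assumes "0 < \<zeta>" "0 < e"
  obtains x where "x \<in> small_supported U \<zeta>" "singular_mass - e < norm (\<phi> x)"
proof -
  have "singular_mass - e < singular_mass"
    using assms by simp
  also have "\<dots> \<le> (SUP x\<in>small_supported U \<zeta>. norm (\<phi> x))"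
    unfolding singular_mass_def using assms by (intro cINF_lower bdd_below_sup_small_supported) simp
  finally show thesis
    using that less_cSUP_iff[OF _ bdd_above_small_supported] zero_in_small_supported assms
    by (metis empty_iff less_imp_le)
qed

lemma singular_mass_bound:
  assumes "0 < e"
  obtains \<zeta> where "0 < \<zeta>" "\<And>x. x \<in> small_supported U \<zeta> \<Longrightarrow> norm (\<phi> x) < singular_mass + e"
proof -
  have "singular_mass < singular_mass + e"
    using assms by simp
  then have "\<exists>\<zeta>\<in>{0<..}. (SUP x\<in>small_supported U \<zeta>. norm (\<phi> x)) < singular_mass + e"
    by (subst (asm) (1) singular_mass_def)
       (simp only: cINF_less_iff[OF _ bdd_below_sup_small_supported] greaterThan_non_empty not_False_eq_True)
  then obtain \<zeta> where \<zeta>: "0 < \<zeta>" "(SUP x\<in>small_supported U \<zeta>. norm (\<phi> x)) < singular_mass + e"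
    by auto
  then show thesis
    using that cSUP_upper[OF _ bdd_above_small_supported] by (meson le_less_trans)
qed

definition abs_cont_on :: "nat set \<Rightarrow> bool"
  where "abs_cont_on A \<longleftrightarrow> (\<forall>c>0. \<exists>\<zeta>>0. \<forall>y\<in>small_supported U \<zeta>. {i. y i \<noteq> 0} \<subseteq> A \<longrightarrow> norm (\<phi> y) < c)"

text \<open>If \<open>C\<close> carries functions of ever smaller support that exhaust the singular mass, then
  the complement of \<open>C\<close> carries none of it: disjointly supported functions, rotated
  appropriately, have additive values.\<close>

lemma abs_cont_on_Compl:
  assumes x: "\<And>k. x k \<in> small_supported U ((1 / 2) ^ k)"
    and mass: "\<And>k. singular_mass - 1 / real (Suc k) < norm (\<phi> (x k))"
    and C: "\<And>k. density U ({i. x k i \<noteq> 0} - C) = 0"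
  shows "abs_cont_on (- C)"
  unfolding abs_cont_on_def
proof (intro allI impI)
  fix c :: real assume c: "0 < c"
  obtain \<zeta> where \<zeta>: "0 < \<zeta>"
    and \<zeta>_bound: "\<And>x. x \<in> small_supported U \<zeta> \<Longrightarrow> norm (\<phi> x) < singular_mass + c / 2"
    using singular_mass_bound[OF half_gt_zero[OF c]] by blast
  \<comment> \<open>\<open>k\<close> is chosen so that the supports of \<open>x k\<close> and
    \<open>y\<close> together have density at most \<open>\<zeta>\<close> and \<open>x k\<close>
    misses less than \<open>c / 2\<close> of the mass.\<close>
  have "\<forall>\<^sub>F k in sequentially. (1 / 2) ^ k < \<zeta> / 2"
    using \<zeta> by (intro order_tendstoD(2)[OF LIMSEQ_power_zero]) auto
  moreover have "\<forall>\<^sub>F k in sequentially. 1 / real (Suc k) < c / 2"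
    using c by (intro order_tendstoD(2)[OF LIMSEQ_Suc[OF lim_const_over_n]]) auto
  ultimately have "\<forall>\<^sub>F k in sequentially. (1 / 2) ^ k < \<zeta> / 2 \<and> 1 / real (Suc k) < c / 2"
    by (rule eventually_conj)
  then obtain k where k: "(1 / 2) ^ k < \<zeta> / 2" "1 / real (Suc k) < c / 2"
    using eventually_happens trivial_limit_sequentially by blast
  show "\<exists>\<zeta>>0. \<forall>y\<in>small_supported U \<zeta>. {i. y i \<noteq> 0} \<subseteq> - C \<longrightarrow> norm (\<phi> y) < c"
  proof (intro exI[of _ "\<zeta> / 2"] conjI ballI impI)
    show "0 < \<zeta> / 2" using \<zeta> by simp
    fix y :: "nat \<Rightarrow> 'k"
    assume y: "y \<in> small_supported U (\<zeta> / 2)" and supp: "{i. y i \<noteq> 0} \<subseteq> - C"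
    \<comment> \<open>Cutting \<open>x k\<close> along \<open>C\<close> leaves its value unchanged,
      since the part off \<open>C\<close> has null support, and makes it disjoint from
      \<open>y\<close>.\<close>
    define x1 where "x1 i = (if i \<in> C then x k i else 0)" for i
    define x2 where "x2 i = (if i \<in> C then 0 else x k i)" for i
    have xk: "norm (x k i) \<le> 1" for i
      using x[of k] by (simp add: small_supported_def)
    have y1: "norm (y i) \<le> 1" for i
      using y by (simp add: small_supported_def)
    have bdd: "bounded (range x1)" "bounded (range x2)" "bounded (range y)"
      using xk y1 by (auto intro!: boundedI[of _ 1] simp: x1_def x2_def)
    have "{i. x2 i \<noteq> 0} = {i. x k i \<noteq> 0} - C"
      by (auto simp: x2_def)
    then have "\<phi> x2 = 0"
      using C[of k] by (intro null_support bdd) simp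
    moreover have "x k = (\<lambda>i. x1 i + x2 i)"
      by (auto simp: x1_def x2_def)
    ultimately have \<phi>x: "\<phi> (x k) = \<phi> x1"
      using add[OF bdd(1,2)] by simp
    obtain u where u: "norm u = 1" "u * \<phi> x1 = of_real (norm (\<phi> x1))"
      using ex_unit_mult_eq_norm by blast
    obtain v where v: "norm v = 1" "v * \<phi> y = of_real (norm (\<phi> y))"
      using ex_unit_mult_eq_norm by blast
    define z where "z i = u * x1 i + v * y i" for i
    have "\<phi> z = \<phi> (\<lambda>i. u * x1 i) + \<phi> (\<lambda>i. v * y i)"
      unfolding z_def
      by (intro add boundedI[of _ 1]) (use xk y1 u v in \<open>auto simp: norm_mult x1_def\<close>)
    also have "\<dots> = of_real (norm (\<phi> x1) + norm (\<phi> y))"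
      using u v bdd by (simp add: scale)
    finally have \<phi>z: "norm (\<phi> z) = norm (\<phi> (x k)) + norm (\<phi> y)"
      by (simp add: \<phi>x del: of_real_add)
    have "y i = 0" if "i \<in> C" for i :: nat
      using that supp by auto
    then have "norm (z i) \<le> 1" for i
      using xk[of i] y1[of i] u(1) v(1) by (simp add: z_def x1_def norm_mult)
    moreover have "density U {i. z i \<noteq> 0} \<le> \<zeta>"
    proof -
      have "density U {i. z i \<noteq> 0} \<le> density U ({i. x k i \<noteq> 0} \<union> {i. y i \<noteq> 0})"
        by (rule density_mono[OF U]) (auto simp: z_def x1_def split: if_splits)
      also have "\<dots> \<le> density U {i. x k i \<noteq> 0} + density U {i. y i \<noteq> 0}"
        by (rule density_Un_le[OF U])
      also have "\<dots> \<le> \<zeta>"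
        using x[of k] y k by (simp add: small_supported_def)
      finally show ?thesis .
    qed
    ultimately have "norm (\<phi> z) < singular_mass + c / 2"
      by (intro \<zeta>_bound) (simp add: small_supported_def)
    \<comment> \<open>\<open>norm (\<phi> z)\<close> is below \<open>singular_mass + c / 2\<close>,
      and its summand from \<open>x k\<close> already exceeds \<open>singular_mass - c / 2\<close>;
      less than \<open>c\<close> is left for \<open>y\<close>.\<close>
    then show "norm (\<phi> y) < c"
      using mass[of k] k \<phi>z by linarith
  qed
qed

text \<open>Infinitely many large values on rotated cosines would survive averaging, whereas by
  orthogonality the averages tend to zero in density.\<close>

lemma finite_large_cos:
  assumes ac: "abs_cont_on A" and \<delta>: "0 < \<delta>"
  shows "finite {a \<in> {0<..<pi}. \<delta> \<le> norm (\<phi> (\<lambda>i. if i \<in> A then of_real (cos (a * real i)) else 0))}"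
    (is "finite ?S")
proof (rule ccontr)
  assume inf: "infinite ?S"
  define r where "r a i = (if i \<in> A then of_real (cos (a * real i)) else (0 :: 'k))" for a i
  have r_le: "norm (r a i) \<le> 1" for a i
    by (simp add: r_def)
  then have r_bdd: "bounded (range (\<lambda>i. c * r a i))" for a c
    by (intro boundedI[of _ "norm c"]) (auto simp: norm_mult mult_left_le)
  obtain \<zeta> where \<zeta>: "0 < \<zeta>"
    and small: "\<And>y. y \<in> small_supported U \<zeta> \<Longrightarrow> {i. y i \<noteq> 0} \<subseteq> A \<Longrightarrow> norm (\<phi> y) < \<delta> / 2"
    using ac half_gt_zero[OF \<delta>] unfolding abs_cont_on_def by blast
  \<comment> \<open>Threshold below which values of the average cost at most
    \<open>\<delta> / 2\<close>; adding 1 to \<open>L\<close> avoids division by zero.\<close>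
  define \<eta> where "\<eta> = \<delta> / (2 * (L + 1))"
  have \<eta>: "0 < \<eta>" "L * \<eta> \<le> \<delta> / 2"
    using \<delta> L_nonneg by (auto simp: \<eta>_def field_simps)
  \<comment> \<open>With this many frequencies, the Chebyshev bound
    \<open>1 / (2 * \<eta>\<^sup>2 * real N)\<close> on the density of large values drops below
    \<open>\<zeta>\<close>.\<close>
  obtain N :: nat where N: "1 / (2 * \<zeta> * \<eta>\<^sup>2) < real N"
    using reals_Archimedean2 by blast
  have "0 < 1 / (2 * \<zeta> * \<eta>\<^sup>2)"
    using \<zeta> \<eta> by simp
  then have N0: "0 < real N"
    using N by linarith
  obtain F where F: "F \<subseteq> ?S" "finite F" "card F = N"
    using infinite_arbitrarily_large[OF inf] by blast
  have "\<forall>a. \<exists>u. norm u = 1 \<and> u * \<phi> (r a) = of_real (norm (\<phi> (r a)))"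
    using ex_unit_mult_eq_norm by metis
  then obtain v where v: "\<And>a. norm (v a) = 1" "\<And>a. v a * \<phi> (r a) = of_real (norm (\<phi> (r a)))"
    by metis
  \<comment> \<open>The average of the rotated cosines. Rotation by \<open>v a\<close> makes every
    value a real of size at least \<open>\<delta>\<close>, so \<open>\<phi> g\<close> has size at
    least \<open>\<delta>\<close> too.\<close>
  define g where "g i = (\<Sum>a\<in>F. of_real (1 / real N) * v a * r a i)" for i
  have "g = (\<lambda>i. \<Sum>a\<in>F. of_real (1 / real N) * v a * r a i)"
    by (simp add: fun_eq_iff g_def)
  then have "\<phi> g = (\<Sum>a\<in>F. \<phi> (\<lambda>i. of_real (1 / real N) * v a * r a i))"
    by (simp only: sum[OF F(2) r_bdd, THEN conjunct1])
  also have "\<dots> = (\<Sum>a\<in>F. of_real (1 / real N * norm (\<phi> (r a))))"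
  proof (rule sum.cong[OF refl])
    fix a
    have "\<phi> (\<lambda>i. of_real (1 / real N) * v a * r a i) = of_real (1 / real N) * (v a * \<phi> (r a))"
      using scale[OF r_bdd[of 1 a, unfolded mult_1_left], of "of_real (1 / real N) * v a"]
      by (simp only: mult.assoc)
    then show "\<phi> (\<lambda>i. of_real (1 / real N) * v a * r a i) = of_real (1 / real N * norm (\<phi> (r a)))"
      by (simp only: v(2) of_real_mult)
  qed
  finally have \<phi>g: "norm (\<phi> g) = (\<Sum>a\<in>F. 1 / real N * norm (\<phi> (r a)))"
    by (simp only: of_real_sum[symmetric] norm_of_real) (simp add: sum_nonneg)
  have "(\<Sum>a\<in>F. 1 / real N * norm (\<phi> (r a))) \<ge> (\<Sum>a\<in>F. 1 / real N * \<delta>)"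
    using F(1) by (intro sum_mono mult_left_mono) (auto simp: r_def[abs_def])
  then have \<phi>g_ge: "norm (\<phi> g) \<ge> \<delta>"
    using \<phi>g F N0 by simp
  have g_le: "norm (g i) \<le> 1" for i
  proof -
    have "norm (g i) \<le> (\<Sum>a\<in>F. 1 / real N)"
      unfolding g_def using r_le v(1)
      by (intro sum_norm_le) (simp add: norm_mult norm_divide divide_right_mono)
    then show ?thesis
      using F N0 by simp
  qed
  define D where "D = {i \<in> A. \<eta> \<le> norm (g i)}"
  have g_norm: "norm (g i) = norm (\<Sum>a\<in>F. cos (a * real i) *\<^sub>R v a) / real N" if "i \<in> A" for i
  proof -
    have "g i = of_real (1 / real N) * (\<Sum>a\<in>F. cos (a * real i) *\<^sub>R v a)"
      using that by (simp add: g_def r_def sum_distrib_left scaleR_conv_of_real mult_ac)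
    then show ?thesis
      by (simp add: norm_mult norm_divide)
  qed
  \<comment> \<open>Chebyshev's inequality: on \<open>D\<close> the unnormalised sum has square at
    least \<open>(\<eta> * real N)\<^sup>2\<close>, while the mean of the squares tends to
    \<open>real N / 2\<close>.\<close>
  have "density U D \<le> (real N / 2) / (\<eta>\<^sup>2 * (real N)\<^sup>2)"
  proof (rule tendsto_le[OF free_ultrafilter_neq_bot[OF U] _ tendsto_density[OF U]])
    let ?h = "\<lambda>i. (norm (\<Sum>a\<in>F. cos (a * real i) *\<^sub>R v a))\<^sup>2"
    have "(\<lambda>n. (\<Sum>i<n. ?h i) / real n) \<longlonglongrightarrow> real N / 2"
      using mean_norm_sum_cos_tendsto[of F v] F v(1) by (auto simp: subset_eq)
    then have "((\<lambda>n. (\<Sum>i<n. ?h i) / real n) \<longlongrightarrow> real N / 2) U"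
      by (rule tendsto_mono[OF free_ultrafilter_le_sequentially[OF U]])
    then show "((\<lambda>n. ((\<Sum>i<n. ?h i) / real n) / (\<eta>\<^sup>2 * (real N)\<^sup>2)) \<longlongrightarrow>
        (real N / 2) / (\<eta>\<^sup>2 * (real N)\<^sup>2)) U"
      by (rule tendsto_divide[OF _ tendsto_const]) (use \<eta> N0 in simp)
    have "rel_freq D n \<le> ((\<Sum>i<n. ?h i) / real n) / (\<eta>\<^sup>2 * (real N)\<^sup>2)" for n
    proof -
      have "real (card (D \<inter> {..<n})) * (\<eta>\<^sup>2 * (real N)\<^sup>2) = (\<Sum>i\<in>D \<inter> {..<n}. (\<eta> * real N)\<^sup>2)"
        by (simp add: power_mult_distrib)
      also have "\<dots> \<le> (\<Sum>i\<in>D \<inter> {..<n}. ?h i)"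
      proof (rule sum_mono)
        fix i assume "i \<in> D \<inter> {..<n}"
        then have "\<eta> * real N \<le> norm (\<Sum>a\<in>F. cos (a * real i) *\<^sub>R v a)"
          using g_norm[of i] N0 mult_right_mono[of \<eta> "norm (g i)" "real N"] by (simp add: D_def)
        then show "(\<eta> * real N)\<^sup>2 \<le> ?h i"
          using \<eta> N0 by (intro power_mono) auto
      qed
      also have "\<dots> \<le> (\<Sum>i<n. ?h i)"
        by (intro sum_mono2) auto
      finally have "real (card (D \<inter> {..<n})) \<le> (\<Sum>i<n. ?h i) / (\<eta>\<^sup>2 * (real N)\<^sup>2)"
        using \<eta> N0 by (simp add: pos_le_divide_eq)
      then have "rel_freq D n \<le> (\<Sum>i<n. ?h i) / (\<eta>\<^sup>2 * (real N)\<^sup>2) / real n"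
        unfolding rel_freq_def by (rule divide_right_mono) simp
      then show ?thesis
        by (simp add: mult.commute)
    qed
    then show "\<forall>\<^sub>F n in U. rel_freq D n \<le> ((\<Sum>i<n. ?h i) / real n) / (\<eta>\<^sup>2 * (real N)\<^sup>2)"
      by simp
  qed
  also have "\<dots> = 1 / (2 * \<eta>\<^sup>2 * real N)"
    using N0 by (simp add: power2_eq_square)
  also have "\<dots> \<le> \<zeta>"
    using N N0 \<zeta> \<eta> by (simp add: field_simps)
  finally have D: "density U D \<le> \<zeta>" .
  \<comment> \<open>Split of \<open>g\<close> at \<open>D\<close>: absolute continuity controls
    \<open>y\<close> by its small support, and the norm bound controls \<open>h\<close> by its small
    values. Together they stay below \<open>\<delta>\<close>.\<close>
  define y where "y i = (if i \<in> D then g i else 0)" for i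
  define h where "h i = (if i \<in> D then 0 else g i)" for i
  have "density U {i. y i \<noteq> 0} \<le> density U D"
    by (intro density_mono[OF U]) (auto simp: y_def)
  then have "y \<in> small_supported U \<zeta>"
    using g_le D by (auto simp: small_supported_def y_def)
  then have "norm (\<phi> y) < \<delta> / 2"
    by (rule small) (auto simp: y_def D_def)
  moreover have "norm (\<phi> h) \<le> L * \<eta>"
  proof (rule bound_scaled[OF _ \<eta>(1)])
    have "g i = 0" if "i \<notin> A" for i
      using that by (simp add: g_def r_def)
    then show "norm (h i) \<le> \<eta>" for i
      using \<eta>(1) by (cases "i \<in> A") (auto simp: h_def D_def)
  qed
  moreover have "\<phi> g = \<phi> y + \<phi> h"
  proof -
    have "g = (\<lambda>i. y i + h i)"
      by (auto simp: y_def h_def)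
    then show ?thesis
      using g_le by (subst add[symmetric]) (auto intro!: boundedI[of _ 1] simp: y_def h_def)
  qed
  ultimately show False
    using \<phi>g_ge \<eta>(2) norm_triangle_ineq[of "\<phi> y" "\<phi> h"] by simp
qed

end

section \<open>A bounded sequence annihilated by countably many functionals\<close>

lemma rel_freq_eq_sum: "rel_freq A n = (\<Sum>i<n. of_bool (i \<in> A)) / real n"
  by (simp add: rel_freq_def Int_commute)

text \<open>The squared cosine has mean 1/2, is at most 1 on \<open>C\<close> and the exceptional
  set, and at most 1/4 elsewhere. If the exceptional set were null, the mean would be at most
  \<open>density U C + 1 / 4\<close>, which is less than 1/2.\<close>

lemma cos_not_null_off_small_set:
  assumes U: "free_ultrafilter U" and C: "density U C < 1 / 4" and a: "a \<in> {0<..<pi}"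
  shows "density U {i. 1 / 2 \<le> norm (if i \<in> C then 0 else of_real (cos (a * real i)) :: 'k::real_normed_field)} \<noteq> 0"
    (is "density U ?D \<noteq> 0")
proof
  assume D: "density U ?D = 0"
  let ?m = "\<lambda>n. (\<Sum>i<n. cos (a * real i) * cos (a * real i)) / real n"
  have "?m n \<le> rel_freq ?D n + rel_freq C n + 1 / 4" for n
  proof -
    have "cos (a * real i) * cos (a * real i) \<le> of_bool (i \<in> ?D) + of_bool (i \<in> C) + 1 / 4" for i
    proof (cases "i \<in> C \<or> i \<in> ?D")
      case True
      have "cos (a * real i) * cos (a * real i) \<le> 1"
        using abs_cos_le_one[of "a * real i"] by (metis abs_mult_self_eq abs_ge_zero mult_le_one)
      with True show ?thesis by auto
    next
      case False
      then have "\<bar>cos (a * real i)\<bar> \<le> 1 / 2" by auto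
      then have "\<bar>cos (a * real i)\<bar> * \<bar>cos (a * real i)\<bar> \<le> 1 / 2 * (1 / 2)"
        by (intro mult_mono) auto
      then show ?thesis
        by (simp add: abs_mult_self_eq)
    qed
    then have "(\<Sum>i<n. cos (a * real i) * cos (a * real i)) \<le>
        (\<Sum>i<n. of_bool (i \<in> ?D) + of_bool (i \<in> C) + 1 / 4)"
      by (intro sum_mono) blast
    then have "?m n \<le> (\<Sum>i<n. of_bool (i \<in> ?D) + of_bool (i \<in> C) + 1 / 4) / real n"
      by (rule divide_right_mono) simp
    also have "\<dots> \<le> rel_freq ?D n + rel_freq C n + 1 / 4"
      unfolding rel_freq_eq_sum sum.distrib add_divide_distrib by (cases "n = 0") auto
    finally show ?thesis .
  qed
  moreover have "(?m \<longlongrightarrow> 1 / 2) U"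
    using mean_cos_mult_cos_tendsto[OF a a] tendsto_mono[OF free_ultrafilter_le_sequentially[OF U]]
    by simp
  moreover have "((\<lambda>n. rel_freq ?D n + rel_freq C n + 1 / 4) \<longlongrightarrow> density U ?D + density U C + 1 / 4) U"
    by (intro tendsto_add tendsto_density[OF U] tendsto_const)
  ultimately have "1 / 2 \<le> density U ?D + density U C + 1 / 4"
    by (intro tendsto_le[OF free_ultrafilter_neq_bot[OF U]]) auto
  with C D show False by simp
qed

theorem null_functionals_not_separating:
  fixes t :: "nat \<Rightarrow> nat" and \<phi> :: "nat \<Rightarrow> (nat \<Rightarrow> 'k::{real_normed_field,real_inner}) \<Rightarrow> 'k"
  assumes t: "strict_mono t"
    and sparse: "(\<lambda>j. real (t j) / real (t (Suc j))) \<longlonglongrightarrow> 0"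
    and T: "\<forall>\<^sub>F n in U. n \<in> range t"
    and \<phi>: "\<And>n. null_functional U (\<phi> n) (L n)"
  obtains x e where "bounded (range x)" "0 < e" "density U {i. e \<le> norm (x i)} \<noteq> 0" "\<And>n. \<phi> n x = 0"
proof -
  have U: "free_ultrafilter U"
    using \<phi>[of 0] by (simp add: null_functional_def)
  define s where "s n = null_functional.singular_mass U (\<phi> n)" for n
  \<comment> \<open>Near-maximisers of the singular mass of all functionals at once. The pairing
    code in the exponent makes all their supports summable, and the shift by 4 makes the total at
    most 1/8.\<close>
  have "\<exists>x. x \<in> small_supported U ((1 / 2) ^ (prod_encode (n, k) + 4)) \<and>
      s n - 1 / real (Suc k) < norm (\<phi> n x)" for n k
    unfolding s_def
    by (rule null_functional.singular_mass_approx[OF \<phi>[of n],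
          of "(1 / 2) ^ (prod_encode (n, k) + 4)" "1 / real (Suc k)"]) auto
  then obtain x where x: "\<And>n k. x n k \<in> small_supported U ((1 / 2) ^ (prod_encode (n, k) + 4))"
    and mass: "\<And>n k. s n - 1 / real (Suc k) < norm (\<phi> n (x n k))"
    by metis
  define B where "B m = {i. case prod_decode m of (n, k) \<Rightarrow> x n k i \<noteq> 0}" for m
  have B: "density U (B m) \<le> (1 / 2) ^ (m + 4)" for m
    using x[of "fst (prod_decode m)" "snd (prod_decode m)"]
    by (simp add: B_def small_supported_def split_beta)
  have "(\<Sum>i<m. density U (B i)) \<le> 1 / 8" for m
  proof -
    have "(\<Sum>i<m. density U (B i)) \<le> (\<Sum>i<m. (1 / 2) ^ (i + 4))"
      by (intro sum_mono B)
    also have "\<dots> = 1 / 8 - (1 / 2) ^ (m + 3)"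
      by (induction m) (simp_all add: power_add field_simps)
    also have "\<dots> \<le> 1 / 8" by simp
    finally show ?thesis .
  qed
  \<comment> \<open>1/5 leaves the gap above 1/8 that the pseudo-union requires and stays below the
    1/4 tolerated by the cosine estimate.\<close>
  then obtain C where C: "density U C \<le> 1 / 5" "\<And>m. density U (B m - C) = 0"
    using sparse_density_pseudo_union[OF t sparse U T, of B "1 / 8" "1 / 5"] by auto
  have ac: "null_functional.abs_cont_on U (\<phi> n) (- C)" for n
  proof (rule null_functional.abs_cont_on_Compl[OF \<phi>, of "x n"])
    fix k
    \<comment> \<open>A pair code is at least its second component, so for fixed \<open>n\<close>
      the supports shrink at the rate needed to detect the singular mass.\<close>
    have "(1 / 2 :: real) ^ (prod_encode (n, k) + 4) \<le> (1 / 2) ^ k"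
      using le_prod_encode_2[of k n] by (intro power_decreasing) auto
    with x[of n k] show "x n k \<in> small_supported U ((1 / 2) ^ k)"
      by (auto simp: small_supported_def intro: order.trans)
    show "null_functional.singular_mass U (\<phi> n) - 1 / real (Suc k) < norm (\<phi> n (x n k))"
      using mass[of n k] by (simp add: s_def)
    show "density U ({i. x n k i \<noteq> 0} - C) = 0"
      using C(2)[of "prod_encode (n, k)"] by (simp add: B_def)
  qed
  define r where "r a = (\<lambda>i. if i \<in> - C then of_real (cos (a * real i)) else (0 :: 'k))" for a
  \<comment> \<open>Every frequency on which some functional is nonzero passes one of the thresholds
    \<open>1 / real (Suc m)\<close>; for each \<open>n\<close> and \<open>m\<close> only finitely
    many do.\<close>
  define E where "E = (\<Union>n. \<Union>m. {a \<in> {0<..<pi}. 1 / real (Suc m) \<le> norm (\<phi> n (r a))})"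
  have "countable E"
    using null_functional.finite_large_cos[OF \<phi> ac] unfolding r_def E_def
    by (intro countable_UN countableI_type countable_finite) auto
  moreover have "uncountable {0<..<pi}"
    using pi_gt_zero uncountable_open_interval by blast
  ultimately have "\<not> {0<..<pi} \<subseteq> E"
    using countable_subset by blast
  then obtain a where a: "a \<in> {0<..<pi}" and nmem: "a \<notin> E"
    by blast
  show thesis
  proof
    show "bounded (range (r a))"
      by (auto intro!: boundedI[of _ 1] simp: r_def)
    show "(0 :: real) < 1 / 2" by simp
    have "(\<lambda>i. if i \<in> C then 0 else of_real (cos (a * real i))) = r a"
      by (auto simp: r_def)
    then show "density U {i. 1 / 2 \<le> norm (r a i)} \<noteq> 0"
      using cos_not_null_off_small_set[OF U _ a, of C, where 'k = 'k] C(1) by (simp add: fun_eq_iff)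
    show "\<phi> n (r a) = 0" for n
    proof (rule ccontr)
      assume "\<phi> n (r a) \<noteq> 0"
      then obtain m where "inverse (real (Suc m)) < norm (\<phi> n (r a))"
        using reals_Archimedean[of "norm (\<phi> n (r a))"] by auto
      then have "1 / real (Suc m) \<le> norm (\<phi> n (r a))"
        by (simp add: inverse_eq_divide)
      with a have "a \<in> E"
        unfolding E_def by blast
      with nmem show False by simp
    qed
  qed
qed

section \<open>The space \<open>\<beta>\<omega>\<close> and extension of finitely additive probabilities\<close>

lemma hat_UNIV: "hat UNIV = {p. ultrafilter p}"
  by (simp add: hat_def)

lemma hat_empty: "hat {} = {}"
  by (auto simp: hat_def ultrafilter_def eventually_False)

lemma hat_Int: "hat (A \<inter> B) = hat A \<inter> hat B"
  by (auto simp: hat_def eventually_conj_iff)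

lemma hat_Compl: "hat (- A) = hat UNIV - hat A"
  using eventually_ultrafilter_not_iff by (auto simp: hat_def)

lemma hat_mono: "A \<subseteq> B \<Longrightarrow> hat A \<subseteq> hat B"
  by (auto simp: hat_def elim: eventually_mono)

lemma hat_Un: "hat (A \<union> B) = hat A \<union> hat B"
proof -
  have "A \<union> B = - (- A \<inter> - B)" by auto
  then show ?thesis
    using hat_mono[of A UNIV] hat_mono[of B UNIV] by (simp only: hat_Compl hat_Int) blast
qed

lemma hat_UN: "finite I \<Longrightarrow> hat (\<Union>i\<in>I. A i) = (\<Union>i\<in>I. hat (A i))"
  by (induction I rule: finite_induct) (simp_all add: hat_empty hat_Un)

text \<open>Principal ultrafilters recover the points of a set from its \<open>hat\<close>.\<close>

lemma hat_subset_iff: "hat A \<subseteq> hat B \<longleftrightarrow> A \<subseteq> B"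
proof
  assume "hat A \<subseteq> hat B"
  show "A \<subseteq> B"
  proof
    fix a assume "a \<in> A"
    then have "principal {a} \<in> hat A"
      by (simp add: hat_def ultrafilter_principal_singleton eventually_principal)
    with \<open>hat A \<subseteq> hat B\<close> show "a \<in> B"
      by (auto simp: hat_def eventually_principal)
  qed
qed (rule hat_mono)

section \<open>Topology of \<beta>\<omega>\<close>

lemma topspace_beta_omega: "topspace beta_omega = {p. ultrafilter p}"
  using hat_mono[of _ UNIV] unfolding beta_omega_def topology_generated_by_topspace hat_UNIV[symmetric]
  by blast

lemma openin_hat: "openin beta_omega (hat A)"
  unfolding beta_omega_def by (rule topology_generated_by_Basis) simp

lemma hat_subset_topspace: "hat A \<subseteq> topspace beta_omega"
  by (auto simp: topspace_beta_omega hat_def)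

text \<open>The generating sets are closed under intersection, so the subbase is already a
  base.\<close>

lemma openin_beta_omegaE:
  assumes "openin beta_omega V" "p \<in> V"
  obtains A where "p \<in> hat A" "hat A \<subseteq> V"
proof -
  have "generate_topology_on (range hat) V"
    using assms(1) unfolding beta_omega_def by (rule openin_topology_generated_by)
  then have "\<forall>p\<in>V. \<exists>A. p \<in> hat A \<and> hat A \<subseteq> V"
  proof (induction rule: generate_topology_on.induct)
    case (Int V W)
    show ?case
    proof
      fix p assume "p \<in> V \<inter> W"
      then obtain A B where "p \<in> hat A" "hat A \<subseteq> V" "p \<in> hat B" "hat B \<subseteq> W"
        using Int by blast
      then show "\<exists>A. p \<in> hat A \<and> hat A \<subseteq> V \<inter> W"
        by (intro exI[of _ "A \<inter> B"]) (auto simp: hat_Int)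
    qed
  qed blast+
  with assms(2) that show thesis by blast
qed

text \<open>Without a finite subcover, \<open>A\<close> and the complements of the
  \<open>B i\<close> generate a proper filter. An ultrafilter below it lies in \<open>hat A\<close>
  but in no \<open>hat (B i)\<close>.\<close>

lemma finite_subcover_hat:
  assumes "hat A \<subseteq> (\<Union>i\<in>I. hat (B i))"
  obtains J where "finite J" "J \<subseteq> I" "A \<subseteq> (\<Union>i\<in>J. B i)"
proof (rule ccontr)
  assume no: "\<not> thesis"
  let ?F = "inf (principal A) (INF i\<in>I. principal (- B i))"
  have "?F \<noteq> bot"
  proof
    assume "?F = bot"
    then have "eventually (\<lambda>_. False) ?F" by simp
    then have "eventually (\<lambda>n. n \<notin> A) (INF i\<in>I. principal (- B i))"
      by (simp add: inf_commute[of "principal A"] eventually_inf_principal del: eventually_False)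
    then obtain J where "finite J" "J \<subseteq> I" "eventually (\<lambda>n. n \<notin> A) (INF i\<in>J. principal (- B i))"
      by (auto simp: eventually_INF[of _ _ I])
    then have "A \<subseteq> (\<Union>i\<in>J. B i)"
      by (auto simp: INF_principal_finite eventually_principal)
    with \<open>finite J\<close> \<open>J \<subseteq> I\<close> no that show False by blast
  qed
  then obtain p where p: "ultrafilter p" "p \<le> ?F"
    by (rule ex_ultrafilter_le)
  then have "p \<in> hat A"
    by (simp add: hat_def le_principal)
  with assms obtain i where i: "i \<in> I" "p \<in> hat (B i)" by blast
  have "p \<le> principal (- B i)"
    using p(2) i(1) by (meson INF_lower le_infE order_trans)
  then have "p \<in> hat (- B i)"
    using p(1) by (simp add: hat_def le_principal)
  with i show False
    by (simp add: hat_Compl)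
qed

lemma compactin_hat: "compactin beta_omega (hat A)"
  unfolding compactin_def
proof (intro conjI allI impI)
  show "hat A \<subseteq> topspace beta_omega" by (rule hat_subset_topspace)
  fix \<V> assume \<V>: "(\<forall>V\<in>\<V>. openin beta_omega V) \<and> hat A \<subseteq> \<Union>\<V>"
  let ?I = "{B. \<exists>V\<in>\<V>. hat B \<subseteq> V}"
  have "hat A \<subseteq> (\<Union>B\<in>?I. hat B)"
  proof
    fix p assume "p \<in> hat A"
    with \<V> obtain V where V: "V \<in> \<V>" "openin beta_omega V" "p \<in> V" by blast
    then obtain B where "p \<in> hat B" "hat B \<subseteq> V"
      using openin_beta_omegaE by metis
    with \<open>V \<in> \<V>\<close> show "p \<in> (\<Union>B\<in>?I. hat B)"
      by blast
  qed
  then obtain J where J: "finite J" "J \<subseteq> ?I" "A \<subseteq> (\<Union>B\<in>J. B)"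
    by (rule finite_subcover_hat)
  then have "\<forall>B\<in>J. \<exists>V. V \<in> \<V> \<and> hat B \<subseteq> V"
    by auto
  then obtain V where V: "\<forall>B\<in>J. V B \<in> \<V> \<and> hat B \<subseteq> V B"
    unfolding bchoice_iff by blast
  have "hat A \<subseteq> (\<Union>B\<in>J. hat B)"
    using hat_mono[OF J(3)] unfolding hat_UN[OF J(1)] .
  also have "\<dots> \<subseteq> \<Union>(V ` J)"
    using V by (intro UN_mono) auto
  finally show "\<exists>\<F>. finite \<F> \<and> \<F> \<subseteq> \<V> \<and> hat A \<subseteq> \<Union>\<F>"
    using J(1) V by (intro exI[of _ "V ` J"]) auto
qed

lemma compact_space_beta_omega: "compact_space beta_omega"
  using compactin_hat[of UNIV] by (simp add: compact_space_def topspace_beta_omega hat_UNIV)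

text \<open>A property on which two ultrafilters disagree holds along one and fails along the other,
  which gives complementary clopen neighbourhoods.\<close>

lemma Hausdorff_space_beta_omega: "Hausdorff_space beta_omega"
  unfolding Hausdorff_space_def
proof (intro allI impI)
  fix p q assume pq: "p \<in> topspace beta_omega \<and> q \<in> topspace beta_omega \<and> p \<noteq> q"
  then obtain P where "eventually P p \<noteq> eventually P q"
    by (auto simp: filter_eq_iff)
  then obtain A where "p \<in> hat A" "q \<in> hat (- A)"
  proof (cases "eventually P p")
    case True
    with \<open>eventually P p \<noteq> eventually P q\<close> pq show thesis
      by (intro that[of "Collect P"])
         (auto simp: hat_def topspace_beta_omega eventually_ultrafilter_not_iff)
  next
    case False
    with \<open>eventually P p \<noteq> eventually P q\<close> pq show thesis
      by (intro that[of "- Collect P"])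
         (auto simp: hat_def topspace_beta_omega eventually_ultrafilter_not_iff)
  qed
  moreover have "disjnt (hat A) (hat (- A))"
    by (auto simp: hat_Compl disjnt_def)
  ultimately show "\<exists>V W. openin beta_omega V \<and> openin beta_omega W \<and> p \<in> V \<and> q \<in> W \<and> disjnt V W"
    using openin_hat by blast
qed

text \<open>Compactness leaves finitely many basic sets, and a finite union of these is again of the
  form \<open>hat A\<close>. Such clopen interpolants let the values on clopen sets determine a
  Radon measure.\<close>

lemma compactin_subset_openin_beta_omega:
  assumes C: "compactin beta_omega C" and V: "openin beta_omega V" "C \<subseteq> V"
  obtains A where "C \<subseteq> hat A" "hat A \<subseteq> V"
proof -
  let ?\<U> = "{hat A | A. hat A \<subseteq> V}"
  have "C \<subseteq> \<Union>?\<U>"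
  proof
    fix p assume "p \<in> C"
    then have "p \<in> V" using V(2) by blast
    then obtain A where "p \<in> hat A" "hat A \<subseteq> V"
      using openin_beta_omegaE[OF V(1)] by metis
    then show "p \<in> \<Union>?\<U>" by blast
  qed
  moreover have "\<forall>W\<in>?\<U>. openin beta_omega W"
    using openin_hat by blast
  ultimately obtain \<F> where \<F>: "finite \<F>" "\<F> \<subseteq> ?\<U>" "C \<subseteq> \<Union>\<F>"
    using C unfolding compactin_def by meson
  have "\<forall>W\<in>\<F>. \<exists>A. W = hat A"
    using \<F>(2) by blast
  then obtain A where "\<forall>W\<in>\<F>. W = hat (A W)"
    unfolding bchoice_iff by blast
  then have "\<Union>\<F> = hat (\<Union>W\<in>\<F>. A W)"
    using \<F>(1) by (simp add: hat_UN)
  moreover from this \<F>(2) have "\<Union>\<F> \<subseteq> V"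
    by blast
  ultimately show thesis
    using that \<F>(3) by metis
qed

lemma less_add_ennreal: "x \<noteq> top \<Longrightarrow> 0 < e \<Longrightarrow> x < x + ennreal e"
  using ennreal_add_left_cancel_less[of x 0 "ennreal e"] by simp

section \<open>Extension of a finitely additive probability to a Radon measure\<close>

locale finitely_additive_prob =
  fixes d :: "nat set \<Rightarrow> real"
  assumes nonneg: "0 \<le> d A"
    and additive: "A \<inter> B = {} \<Longrightarrow> d (A \<union> B) = d A + d B"
    and total: "d UNIV = 1"
begin

lemma empty: "d {} = 0"
  using additive[of "{}" "{}"] by simp

lemma mono: "A \<subseteq> B \<Longrightarrow> d A \<le> d B"
  using additive[of A "B - A"] nonneg[of "B - A"] by (simp add: Un_absorb1)

lemma Un_le: "d (A \<union> B) \<le> d A + d B"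
  using additive[of A "B - A"] mono[of "B - A" B] by simp

lemma UN_le: "finite I \<Longrightarrow> d (\<Union>i\<in>I. A i) \<le> (\<Sum>i\<in>I. d (A i))"
proof (induction I rule: finite_induct)
  case (insert i I)
  then show ?case using Un_le[of "A i" "\<Union>i\<in>I. A i"] by simp
qed (simp add: empty)

text \<open>The prospective measure of open sets, approximated from inside by clopen sets.\<close>

definition inner_content :: "nat filter set \<Rightarrow> ennreal"
  where "inner_content V = (SUP A\<in>{A. hat A \<subseteq> V}. ennreal (d A))"

text \<open>The induced outer measure. If \<open>S\<close> is not contained in the space, no open
  set covers it and the infimum is top; hence the containment premises below.\<close>

definition outer_content :: "nat filter set \<Rightarrow> ennreal"
  where "outer_content S = (INF V\<in>{V. openin beta_omega V \<and> S \<subseteq> V}. inner_content V)"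

lemma inner_content_mono: "V \<subseteq> W \<Longrightarrow> inner_content V \<le> inner_content W"
  unfolding inner_content_def by (rule SUP_subset_mono) auto

lemma inner_content_hat: "inner_content (hat A) = ennreal (d A)"
  unfolding inner_content_def
  by (rule antisym[OF SUP_least SUP_upper]) (auto simp: hat_subset_iff mono ennreal_leI)

lemma le_inner_content: "hat A \<subseteq> V \<Longrightarrow> ennreal (d A) \<le> inner_content V"
  unfolding inner_content_def by (rule SUP_upper) simp

text \<open>A clopen set inside the union is compact, so finitely many clopen pieces cover it and
  finite subadditivity of \<open>d\<close> suffices.\<close>

lemma inner_content_UN_le:
  fixes V :: "nat \<Rightarrow> nat filter set"
  assumes "\<And>i. openin beta_omega (V i)"
  shows "inner_content (\<Union>i. V i) \<le> (\<Sum>i. inner_content (V i))"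
  unfolding inner_content_def[of "\<Union>i. V i"]
proof (rule SUP_least, clarify)
  fix A assume A: "hat A \<subseteq> (\<Union>i. V i)"
  \<comment> \<open>Each piece carries the index of the open set containing it, so that the finite
    subcover can be regrouped into one set \<open>B i\<close> for each \<open>V i\<close>.\<close>
  let ?I = "{(i, B). hat B \<subseteq> V i}"
  have "hat A \<subseteq> (\<Union>x\<in>?I. hat (snd x))"
  proof
    fix p assume "p \<in> hat A"
    then obtain i where "p \<in> V i" using A by blast
    then obtain B where "p \<in> hat B" "hat B \<subseteq> V i"
      using openin_beta_omegaE[OF assms] by metis
    then show "p \<in> (\<Union>x\<in>?I. hat (snd x))" by force
  qed
  then obtain J where J: "finite J" "J \<subseteq> ?I" "A \<subseteq> (\<Union>x\<in>J. snd x)"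
    by (rule finite_subcover_hat)
  define B where "B i = (\<Union>x\<in>{x\<in>J. fst x = i}. snd x)" for i
  have hatB: "hat (B i) \<subseteq> V i" for i
  proof -
    have "hat (B i) = (\<Union>x\<in>{x\<in>J. fst x = i}. hat (snd x))"
      unfolding B_def using J(1) by (intro hat_UN) simp
    also have "\<dots> \<subseteq> V i"
      using J(2) by (intro UN_least) fastforce
    finally show ?thesis .
  qed
  have "A \<subseteq> (\<Union>i\<in>fst ` J. B i)"
  proof
    fix a assume "a \<in> A"
    then obtain x where "x \<in> J" "a \<in> snd x"
      using J(3) by blast
    then have "fst x \<in> fst ` J" "a \<in> B (fst x)"
      unfolding B_def by blast+
    then show "a \<in> (\<Union>i\<in>fst ` J. B i)" by blast
  qed
  then have "d A \<le> (\<Sum>i\<in>fst ` J. d (B i))"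
    using J(1) by (intro order.trans[OF mono UN_le]) auto
  then have "ennreal (d A) \<le> (\<Sum>i\<in>fst ` J. ennreal (d (B i)))"
    by (simp add: sum_ennreal nonneg ennreal_leI)
  also have "\<dots> \<le> (\<Sum>i\<in>fst ` J. inner_content (V i))"
    by (intro sum_mono le_inner_content hatB)
  also have "\<dots> \<le> (\<Sum>i. inner_content (V i))"
    using J(1) by (intro sum_le_suminf) auto
  finally show "ennreal (d A) \<le> (\<Sum>i. inner_content (V i))" .
qed

lemma outer_content_open: "openin beta_omega V \<Longrightarrow> outer_content V = inner_content V"
  unfolding outer_content_def by (rule antisym[OF INF_lower INF_greatest]) (auto intro: inner_content_mono)

lemma outer_content_mono: "S \<subseteq> S' \<Longrightarrow> outer_content S \<le> outer_content S'"
  unfolding outer_content_def by (rule INF_superset_mono) auto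

lemma outer_content_hat: "outer_content (hat A) = ennreal (d A)"
  by (simp add: outer_content_open openin_hat inner_content_hat)

lemma outer_content_topspace: "outer_content (topspace beta_omega) = 1"
  using outer_content_hat[of UNIV] by (simp add: topspace_beta_omega hat_UNIV total)

lemma outer_content_le_1: "S \<subseteq> topspace beta_omega \<Longrightarrow> outer_content S \<le> 1"
  using outer_content_mono outer_content_topspace by metis

text \<open>Open supersets are chosen with excess \<open>e / 2 ^ Suc i\<close>, in total
  \<open>e\<close>; strict approximation is possible because the content is at most 1.\<close>

lemma outer_content_UN_le:
  fixes S :: "nat \<Rightarrow> nat filter set"
  assumes S: "\<And>i. S i \<subseteq> topspace beta_omega"
  shows "outer_content (\<Union>i. S i) \<le> (\<Sum>i. outer_content (S i))"
proof (rule ennreal_le_epsilon)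
  fix e :: real assume e: "0 < e"
  have "\<exists>V. openin beta_omega V \<and> S i \<subseteq> V \<and> inner_content V \<le> outer_content (S i) + ennreal (e * (1 / 2) ^ Suc i)" for i
  proof -
    have "outer_content (S i) < outer_content (S i) + ennreal (e * (1 / 2) ^ Suc i)"
      using e outer_content_le_1[OF S, of i]
      by (intro less_add_ennreal) (auto simp: top_unique)
    then show ?thesis
      by (subst (asm) (1) outer_content_def) (auto simp: INF_less_iff intro: less_imp_le)
  qed
  then obtain V where V: "\<And>i. openin beta_omega (V i)" "\<And>i. S i \<subseteq> V i"
    "\<And>i. inner_content (V i) \<le> outer_content (S i) + ennreal (e * (1 / 2) ^ Suc i)"
    by metis
  have "outer_content (\<Union>i. S i) \<le> inner_content (\<Union>i. V i)"
    using V by (subst outer_content_open[symmetric]) (auto intro!: outer_content_mono)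
  also have "\<dots> \<le> (\<Sum>i. inner_content (V i))"
    using V by (intro inner_content_UN_le)
  also have "\<dots> \<le> (\<Sum>i. outer_content (S i) + ennreal (e * (1 / 2) ^ Suc i))"
    using V by (intro suminf_le) auto
  also have "\<dots> = (\<Sum>i. outer_content (S i)) + (\<Sum>i. ennreal (e * (1 / 2) ^ Suc i))"
    by (rule suminf_add[symmetric]) auto
  also have "(\<Sum>i. ennreal (e * (1 / 2) ^ Suc i)) = ennreal e"
    using e sums_mult[OF power_half_series, of e]
    by (subst suminf_ennreal_eq[where x = e]) auto
  finally show "outer_content (\<Union>i. S i) \<le> (\<Sum>i. outer_content (S i)) + ennreal e" .
qed

text \<open>Caratheodory's inequality for open test sets. \<open>W - V\<close> need not be open, so
  \<open>V \<inter> W\<close> is approximated by a clopen \<open>hat A\<close>; then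
  \<open>W - hat A\<close> is open, contains \<open>W - V\<close>, and its clopen subsets are
  disjoint from \<open>hat A\<close>.\<close>

lemma inner_content_split:
  assumes "openin beta_omega V" "openin beta_omega W"
  shows "inner_content (V \<inter> W) + outer_content (W - V) \<le> inner_content W"
proof -
  have *: "ennreal (d A) + outer_content (W - V) \<le> inner_content W" if A: "hat A \<subseteq> V \<inter> W" for A
  proof -
    have "W - hat A = W \<inter> hat (- A)"
      using openin_subset[OF assms(2)] by (auto simp: hat_Compl hat_UNIV topspace_beta_omega)
    then have "openin beta_omega (W - hat A)"
      using assms(2) openin_hat by auto
    then have "outer_content (W - V) \<le> inner_content (W - hat A)"
      using A by (subst outer_content_open[symmetric]) (auto intro: outer_content_mono)
    moreover have "ennreal (d A) + inner_content (W - hat A) \<le> inner_content W"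
      unfolding inner_content_def[of "W - hat A"]
    proof (subst ennreal_SUP_add_right)
      show "(SUP B\<in>{B. hat B \<subseteq> W - hat A}. ennreal (d A) + ennreal (d B)) \<le> inner_content W"
      proof (rule SUP_least, clarify)
        fix B assume B: "hat B \<subseteq> W - hat A"
        then have "hat (A \<inter> B) \<subseteq> hat {}"
          by (auto simp: hat_Int)
        then have "A \<inter> B = {}"
          by (simp add: hat_subset_iff)
        then have "ennreal (d A) + ennreal (d B) = ennreal (d (A \<union> B))"
          by (simp add: additive nonneg)
        also have "\<dots> \<le> inner_content W"
          using A B by (intro le_inner_content) (auto simp: hat_Un)
        finally show "ennreal (d A) + ennreal (d B) \<le> inner_content W" .
      qed
    qed (auto intro: exI[of _ "{}"] simp: hat_empty)
    ultimately show ?thesis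
      by (meson add_left_mono order.trans)
  qed
  have "inner_content (V \<inter> W) + outer_content (W - V) = (SUP A\<in>{A. hat A \<subseteq> V \<inter> W}. ennreal (d A) + outer_content (W - V))"
    unfolding inner_content_def[of "V \<inter> W"]
    by (subst ennreal_SUP_add_left) (auto intro: exI[of _ "{}"] simp: hat_empty)
  also have "\<dots> \<le> inner_content W"
    using * by (intro SUP_least) auto
  finally show ?thesis .
qed

abbreviation borel_beta :: "nat filter set set"
  where "borel_beta \<equiv> sigma_sets (topspace beta_omega) {V. openin beta_omega V}"

text \<open>Caratheodory's construction: open sets split every set additively, so the Borel sets lie
  in the sigma-algebra on which the outer measure is countably additive.\<close>

lemma measure_space_outer: "measure_space (topspace beta_omega) borel_beta outer_content"
proof -
  let ?\<Omega> = "topspace beta_omega"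
  interpret P: sigma_algebra ?\<Omega> "Pow ?\<Omega>"
    by (rule sigma_algebra_Pow)
  have oms: "outer_measure_space (Pow ?\<Omega>) outer_content"
    unfolding outer_measure_space_def
  proof (intro conjI)
    show "positive (Pow ?\<Omega>) outer_content"
      using outer_content_hat[of "{}"] by (simp add: positive_def hat_empty empty)
    show "increasing (Pow ?\<Omega>) outer_content"
      by (simp add: increasing_def outer_content_mono)
    show "countably_subadditive (Pow ?\<Omega>) outer_content"
      unfolding countably_subadditive_def
    proof (intro allI impI)
      fix S :: "nat \<Rightarrow> nat filter set"
      assume "range S \<subseteq> Pow ?\<Omega>"
      then show "outer_content (\<Union>i. S i) \<le> (\<Sum>i. outer_content (S i))"
        by (intro outer_content_UN_le) auto
    qed
  qed
  have "V \<in> lambda_system ?\<Omega> (Pow ?\<Omega>) outer_content" if V: "openin beta_omega V" for V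
    unfolding P.lambda_system_eq
  proof (intro CollectI conjI ballI)
    show "V \<in> Pow ?\<Omega>" using openin_subset[OF V] by simp
    fix S assume S: "S \<in> Pow ?\<Omega>"
    show "outer_content (S \<inter> V) + outer_content (S - V) = outer_content S"
    proof (rule antisym)
      show "outer_content S \<le> outer_content (S \<inter> V) + outer_content (S - V)"
      proof -
        \<comment> \<open>Padding with empty sets derives binary subadditivity from the countable
          one.\<close>
        let ?B = "\<lambda>i::nat. if i = 0 then S \<inter> V else if i = 1 then S - V else {}"
        have "outer_content (\<Union>i. ?B i) \<le> (\<Sum>i. outer_content (?B i))"
          using S by (intro outer_content_UN_le) auto
        moreover have "(\<Union>i. ?B i) = S"
          by (auto split: if_splits intro: exI[of _ 0] exI[of _ 1])
        moreover have "(\<Sum>i. outer_content (?B i)) = (\<Sum>i\<in>{0,1}. outer_content (?B i))"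
          using outer_content_hat[of "{}"] by (intro suminf_finite) (auto simp: hat_empty empty)
        ultimately show ?thesis by simp
      qed
      show "outer_content (S \<inter> V) + outer_content (S - V) \<le> outer_content S"
        unfolding outer_content_def[of S]
      proof (rule INF_greatest, clarify)
        fix W assume W: "openin beta_omega W" "S \<subseteq> W"
        have "outer_content (S \<inter> V) \<le> inner_content (V \<inter> W)"
          using W V by (subst outer_content_open[symmetric]) (auto intro: outer_content_mono)
        moreover have "outer_content (S - V) \<le> outer_content (W - V)"
          using W by (intro outer_content_mono) auto
        ultimately show "outer_content (S \<inter> V) + outer_content (S - V) \<le> inner_content W"
          using inner_content_split[OF V W(1)] by (meson add_mono order.trans)
      qed
    qed
  qed
  moreover have ms: "measure_space ?\<Omega> (lambda_system ?\<Omega> (Pow ?\<Omega>) outer_content) outer_content"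
    using P.caratheodory_lemma[OF oms] .
  moreover from ms have "sigma_algebra ?\<Omega> (lambda_system ?\<Omega> (Pow ?\<Omega>) outer_content)"
    by (simp add: measure_space_def)
  ultimately have "borel_beta \<subseteq> lambda_system ?\<Omega> (Pow ?\<Omega>) outer_content"
    by (intro sigma_algebra.sigma_sets_subset) auto
  with ms show ?thesis
    by (intro measure_down[OF ms] sigma_algebra_sigma_sets) (auto dest: openin_subset)
qed

definition extension :: "nat filter measure"
  where "extension = measure_of (topspace beta_omega) {V. openin beta_omega V} outer_content"

lemma space_extension: "space extension = topspace beta_omega"
  unfolding extension_def by (rule space_measure_of) (auto dest: openin_subset)

lemma sets_extension: "sets extension = borel_beta"
  unfolding extension_def by (rule sets_measure_of) (auto dest: openin_subset)

lemma emeasure_extension: "B \<in> borel_beta \<Longrightarrow> emeasure extension B = outer_content B"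
  using measure_space_outer
  by (intro emeasure_measure_of[OF extension_def])
     (auto simp: measure_space_def sets_extension dest: openin_subset)

lemma prob_space_extension: "prob_space extension"
  by (rule prob_spaceI) (simp add: space_extension emeasure_extension sigma_sets_top outer_content_topspace)

lemma measure_extension_hat: "measure extension (hat A) = d A"
  by (simp add: measure_def emeasure_extension sigma_sets.Basic openin_hat outer_content_hat nonneg)

text \<open>Inner regularity is outer regularity of the complement: the complement of an open
  superset of \<open>space extension - B\<close> is closed, hence compact, and lies in
  \<open>B\<close>.\<close>

lemma radon_probability_extension: "radon_probability beta_omega extension"
  unfolding radon_probability_def
proof (intro conjI ballI)
  interpret prob_space extension by (rule prob_space_extension)
  show "prob_space extension" by (rule prob_space_extension)
  show "space extension = topspace beta_omega" by (rule space_extension)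
  show "sets extension = borel_beta" by (rule sets_extension)
  fix B assume B: "B \<in> sets extension"
  show "emeasure extension B = (SUP C\<in>{C. compactin beta_omega C \<and> C \<subseteq> B}. emeasure extension C)"
  proof (rule antisym)
    show "(SUP C\<in>{C. compactin beta_omega C \<and> C \<subseteq> B}. emeasure extension C) \<le> emeasure extension B"
      using B by (intro SUP_least emeasure_mono) auto
    show "emeasure extension B \<le> (SUP C\<in>{C. compactin beta_omega C \<and> C \<subseteq> B}. emeasure extension C)"
    proof (rule ennreal_le_epsilon)
      fix e :: real assume e: "0 < e"
      have "emeasure extension (space extension - B) < emeasure extension (space extension - B) + ennreal e"
        using e by (intro less_add_ennreal) auto
      then have "outer_content (space extension - B) < emeasure extension (space extension - B) + ennreal e"
        using B by (simp add: emeasure_extension flip: sets_extension)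
      then obtain V where V: "openin beta_omega V" "space extension - B \<subseteq> V"
        "inner_content V < emeasure extension (space extension - B) + ennreal e"
        by (auto simp: outer_content_def INF_less_iff)
      have Vs: "V \<in> sets extension"
        using V by (simp add: sets_extension sigma_sets.Basic)
      have "measure extension V \<le> measure extension (space extension - B) + e"
      proof -
        have "emeasure extension V \<le> emeasure extension (space extension - B) + ennreal e"
          using V Vs by (simp add: emeasure_extension outer_content_open flip: sets_extension)
        then show ?thesis
          using e by (simp add: emeasure_eq_measure flip: ennreal_plus)
      qed
      then have "measure extension B \<le> measure extension (space extension - V) + e"
        using B Vs by (simp add: prob_compl)
      then have le: "emeasure extension B \<le> emeasure extension (space extension - V) + ennreal e"
        using e by (simp add: emeasure_eq_measure flip: ennreal_plus)
      have "closedin beta_omega (space extension - V)"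
        using V by (simp add: space_extension closedin_diff)
      then have "compactin beta_omega (space extension - V)"
        by (rule closedin_compact_space[OF compact_space_beta_omega])
      moreover have "space extension - V \<subseteq> B"
        using V by blast
      ultimately have "emeasure extension (space extension - V) \<le>
          (SUP C\<in>{C. compactin beta_omega C \<and> C \<subseteq> B}. emeasure extension C)"
        by (intro SUP_upper) simp
      with le show "emeasure extension B \<le>
          (SUP C\<in>{C. compactin beta_omega C \<and> C \<subseteq> B}. emeasure extension C) + ennreal e"
        by (meson add_right_mono order.trans)
    qed
  qed
qed

text \<open>Inner regularity reduces to compact subsets of \<open>V\<close>, and between such a set
  and \<open>V\<close> there is a clopen set, whose measure is prescribed.\<close>

lemma emeasure_open_radon:
  assumes M: "radon_probability beta_omega M" and d: "\<And>A. measure M (hat A) = d A"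
    and V: "openin beta_omega V"
  shows "emeasure M V = inner_content V"
proof -
  interpret prob_space M
    using M by (simp add: radon_probability_def)
  have open_sets: "W \<in> sets M" if "openin beta_omega W" for W
    using M that by (simp add: radon_probability_def sigma_sets.Basic)
  have hat: "emeasure M (hat A) = ennreal (d A)" for A
    by (simp add: emeasure_eq_measure d)
  show ?thesis
  proof (rule antisym)
    have "emeasure M V = (SUP C\<in>{C. compactin beta_omega C \<and> C \<subseteq> V}. emeasure M C)"
      using M open_sets[OF V] by (simp add: radon_probability_def)
    also have "\<dots> \<le> inner_content V"
    proof (rule SUP_least, clarify)
      fix C assume C: "compactin beta_omega C" "C \<subseteq> V"
      then obtain A where A: "C \<subseteq> hat A" "hat A \<subseteq> V"
        using compactin_subset_openin_beta_omega V by blast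
      have "emeasure M C \<le> emeasure M (hat A)"
        using A open_sets[OF openin_hat] by (intro emeasure_mono)
      also have "\<dots> \<le> inner_content V"
        using A by (simp add: hat le_inner_content)
      finally show "emeasure M C \<le> inner_content V" .
    qed
    finally show "emeasure M V \<le> inner_content V" .
    show "inner_content V \<le> emeasure M V"
      unfolding inner_content_def using open_sets[OF V] by (intro SUP_least) (auto simp flip: hat intro: emeasure_mono)
  qed
qed

text \<open>The values on open sets are forced, by complements those on compact sets, and by inner
  regularity those on all Borel sets.\<close>

lemma radon_probability_unique:
  assumes M: "radon_probability beta_omega M" "\<And>A. measure M (hat A) = d A"
    and N: "radon_probability beta_omega N" "\<And>A. measure N (hat A) = d A"
  shows "M = N"
proof (rule measure_eqI)
  interpret M: prob_space M using M by (simp add: radon_probability_def)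
  interpret N: prob_space N using N by (simp add: radon_probability_def)
  show sets: "sets M = sets N"
    using M N by (simp add: radon_probability_def)
  have "emeasure M C = emeasure N C" if "compactin beta_omega C" for C
  proof -
    let ?V = "topspace beta_omega - C"
    have "closedin beta_omega C"
      by (rule compactin_imp_closedin[OF Hausdorff_space_beta_omega that])
    then have V: "openin beta_omega ?V" and C: "C = topspace beta_omega - ?V"
      using closedin_subset by fastforce+
    have sp: "space M = topspace beta_omega" "space N = topspace beta_omega"
      and "?V \<in> sets M" "?V \<in> sets N"
      using M N V by (simp_all add: radon_probability_def sigma_sets.Basic)
    then have "measure M C = 1 - measure M ?V" "measure N C = 1 - measure N ?V"
      using M.prob_compl[of ?V] N.prob_compl[of ?V] C by auto
    moreover have "measure M ?V = measure N ?V"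
      using emeasure_open_radon[OF M V] emeasure_open_radon[OF N V] by (simp add: measure_def)
    ultimately show ?thesis
      by (simp add: M.emeasure_eq_measure N.emeasure_eq_measure)
  qed
  then show "emeasure M B = emeasure N B" if "B \<in> sets M" for B
  proof -
    have "emeasure M B = (SUP C\<in>{C. compactin beta_omega C \<and> C \<subseteq> B}. emeasure M C)"
      using M(1) that by (simp add: radon_probability_def)
    also have "\<dots> = (SUP C\<in>{C. compactin beta_omega C \<and> C \<subseteq> B}. emeasure N C)"
      using \<open>\<And>C. compactin beta_omega C \<Longrightarrow> emeasure M C = emeasure N C\<close> by (intro SUP_cong) auto
    also have "\<dots> = emeasure N B"
      using N(1) that sets by (simp add: radon_probability_def)
    finally show ?thesis .
  qed
qed

end

text \<open>Existence and uniqueness together justify the definite description in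
  \<open>density_measure\<close>.\<close>

lemma density_measure_radon:
  assumes U: "free_ultrafilter U"
  shows "radon_probability beta_omega (density_measure U)"
    and "measure (density_measure U) (hat A) = density U A"
proof -
  interpret finitely_additive_prob "density U"
    using density_nonneg[OF U] density_Un_disjoint[OF U] density_UNIV[OF U] by unfold_locales
  have "radon_probability beta_omega (density_measure U) \<and>
      (\<forall>A. measure (density_measure U) (hat A) = density U A)"
    unfolding density_measure_def
  proof (rule theI[of _ extension])
    show "radon_probability beta_omega extension \<and> (\<forall>A. measure extension (hat A) = density U A)"
      using radon_probability_extension measure_extension_hat by simp
    show "M = extension"
      if "radon_probability beta_omega M \<and> (\<forall>A. measure M (hat A) = density U A)" for M
      using that by (intro radon_probability_unique radon_probability_extension measure_extension_hat) simp_all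
  qed
  then show "radon_probability beta_omega (density_measure U)"
    and "measure (density_measure U) (hat A) = density U A"
    by blast+
qed

section \<open>The support of the density measure\<close>

context
  fixes U :: "nat filter"
  assumes U: "free_ultrafilter U"
begin

lemma not_in_hat_if_in_support:
  assumes p: "p \<in> measure_support beta_omega (density_measure U)" and A: "density U A = 0"
  shows "p \<notin> hat A"
proof
  assume "p \<in> hat A"
  interpret prob_space "density_measure U"
    using density_measure_radon(1)[OF U] by (simp add: radon_probability_def)
  have "0 < emeasure (density_measure U) (hat A)"
    using p \<open>p \<in> hat A\<close> openin_hat by (simp add: measure_support_def)
  then show False
    using A by (simp add: emeasure_eq_measure density_measure_radon(2)[OF U])
qed

text \<open>If \<open>hat A\<close> missed the support, null clopen sets would cover it, finitely
  many by compactness, and \<open>A\<close> would be null.\<close>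

lemma ex_in_support_hat:
  assumes A: "density U A \<noteq> 0"
  obtains p where "p \<in> measure_support beta_omega (density_measure U)" "p \<in> hat A"
proof (rule ccontr)
  let ?M = "density_measure U"
  assume no: "\<not> thesis"
  interpret M: prob_space ?M
    using density_measure_radon(1)[OF U] by (simp add: radon_probability_def)
  interpret finitely_additive_prob "density U"
    using density_nonneg[OF U] density_Un_disjoint[OF U] density_UNIV[OF U] by unfold_locales
  have open_sets: "V \<in> sets ?M" if "openin beta_omega V" for V
    using density_measure_radon(1)[OF U] that by (simp add: radon_probability_def sigma_sets.Basic)
  have "hat A \<subseteq> (\<Union>B\<in>{B. density U B = 0}. hat B)"
  proof
    fix p assume p: "p \<in> hat A"
    then have "p \<notin> measure_support beta_omega ?M"
      using no that by blast
    then obtain V where V: "openin beta_omega V" "p \<in> V" "emeasure ?M V = 0"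
      using p hat_subset_topspace by (auto simp: measure_support_def)
    then obtain B where B: "p \<in> hat B" "hat B \<subseteq> V"
      using openin_beta_omegaE by metis
    have "emeasure ?M (hat B) \<le> emeasure ?M V"
      using B open_sets[OF V(1)] by (intro emeasure_mono)
    then have "density U B = 0"
      using V(3) by (simp add: measure_def flip: density_measure_radon(2)[OF U])
    with B show "p \<in> (\<Union>B\<in>{B. density U B = 0}. hat B)"
      by blast
  qed
  then obtain J where J: "finite J" "J \<subseteq> {B. density U B = 0}" "A \<subseteq> (\<Union>B\<in>J. B)"
    by (rule finite_subcover_hat)
  have "density U A \<le> (\<Sum>B\<in>J. density U B)"
    using mono[OF J(3)] UN_le[OF J(1), of "\<lambda>B. B"] by linarith
  also have "\<dots> = 0"
    using J(2) by (intro sum.neutral) auto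
  finally show False
    using A nonneg[of A] by simp
qed

end

text \<open>This is the continuous extension of \<open>x\<close> to \<beta>\<omega>: ultrafilters
  containing a set where \<open>x\<close> varies little have nearby limits.\<close>

lemma continuous_map_Lim:
  fixes x :: "nat \<Rightarrow> 'b::heine_borel"
  assumes x: "bounded (range x)"
  shows "continuous_map beta_omega euclidean (\<lambda>p. Lim p x)"
  unfolding continuous_map_def
proof (intro conjI allI impI)
  fix W :: "'b set" assume "openin euclidean W"
  then have W: "open W" by simp
  show "openin beta_omega {p \<in> topspace beta_omega. Lim p x \<in> W}"
  proof (subst openin_subopen, intro ballI)
    fix p assume p: "p \<in> {p \<in> topspace beta_omega. Lim p x \<in> W}"
    \<comment> \<open>A closed ball inside \<open>W\<close> is needed, since limits of values in the
      open ball may lie on its boundary.\<close>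
    then obtain e where e: "0 < e" "cball (Lim p x) e \<subseteq> W"
      using W open_contains_cball by blast
    let ?A = "{n. x n \<in> ball (Lim p x) e}"
    have "\<forall>\<^sub>F n in p. n \<in> ?A"
      using p e topological_tendstoD[OF ultrafilter_tendsto_Lim[OF _ x], of p "ball (Lim p x) e"]
      by (simp add: topspace_beta_omega)
    then have "p \<in> hat ?A"
      using p by (simp add: hat_def topspace_beta_omega)
    moreover have "Lim q x \<in> W" if "q \<in> hat ?A" for q
    proof -
      from that have q: "ultrafilter q" "\<forall>\<^sub>F n in q. x n \<in> cball (Lim p x) e"
        by (auto simp: hat_def elim: eventually_mono)
      have "Lim q x \<in> cball (Lim p x) e"
        by (rule Lim_in_closed_set[OF closed_cball q(2) ultrafilterD_neq_bot[OF q(1)]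
              ultrafilter_tendsto_Lim[OF q(1) x]])
      with e show ?thesis by blast
    qed
    ultimately show "\<exists>T. openin beta_omega T \<and> p \<in> T \<and> T \<subseteq> {p \<in> topspace beta_omega. Lim p x \<in> W}"
      using openin_hat hat_subset_topspace by (intro exI[of _ "hat ?A"]) blast
  qed
qed simp

section \<open>Approximability\<close>

lemma restrict_in_cont_space:
  "continuous_map K euclidean f \<Longrightarrow> (\<lambda>x\<in>topspace K. f x) \<in> cont_space K"
  by (auto simp: cont_space_def intro: continuous_map_eq)

lemma add_in_cont_space:
  fixes f g :: "'a \<Rightarrow> 'k::real_normed_field"
  assumes "f \<in> cont_space K" "g \<in> cont_space K"
  shows "(\<lambda>x\<in>topspace K. f x + g x) \<in> cont_space K"
  using assms
  by (intro restrict_in_cont_space) (simp add: cont_space_def continuous_map_atin tendsto_add)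

lemma scale_in_cont_space:
  fixes f :: "'a \<Rightarrow> 'k::real_normed_field"
  assumes "f \<in> cont_space K"
  shows "(\<lambda>x\<in>topspace K. c * f x) \<in> cont_space K"
  using assms
  by (intro restrict_in_cont_space) (simp add: cont_space_def continuous_map_atin tendsto_mult_left)

lemma evaluation_in_dual_unit_ball:
  assumes "p \<in> topspace K"
  shows "(\<lambda>f\<in>cont_space K. f p) \<in> (dual_unit_ball K :: (('a \<Rightarrow> 'k::real_normed_field) \<Rightarrow> 'k) set)"
  using assms by (simp add: dual_unit_ball_def add_in_cont_space scale_in_cont_space)

lemma zero_in_dual_unit_ball:
  "(\<lambda>f\<in>cont_space K. 0) \<in> (dual_unit_ball K :: (('a \<Rightarrow> 'k::real_normed_field) \<Rightarrow> 'k) set)"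
  by (simp add: dual_unit_ball_def add_in_cont_space scale_in_cont_space)

lemma topspace_weak_star_unit_ball: "topspace (weak_star_unit_ball K) = dual_unit_ball K"
  by (auto simp: weak_star_unit_ball_def PiE_def dual_unit_ball_def)

text \<open>Evaluation at \<open>p\<close> belongs to the dual ball, and not vanishing at
  \<open>f\<close> is a weak-star open condition. A countable dense set therefore meets it.\<close>

lemma approximable_imp_separating:
  assumes "approximable TYPE('k::real_normed_field) K"
  shows "\<exists>\<psi> :: nat \<Rightarrow> ('a \<Rightarrow> 'k::real_normed_field) \<Rightarrow> 'k. (\<forall>n. \<psi> n \<in> dual_unit_ball K) \<and>
    (\<forall>f\<in>cont_space K. \<forall>p\<in>topspace K. f p \<noteq> 0 \<longrightarrow> (\<exists>n. \<psi> n f \<noteq> 0))"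
proof -
  let ?W = "weak_star_unit_ball K :: (('a \<Rightarrow> 'k) \<Rightarrow> 'k) topology"
  obtain C where C: "countable C" "C \<subseteq> dual_unit_ball K" "?W closure_of C = dual_unit_ball K"
    using assms unfolding approximable_def separable_space_def topspace_weak_star_unit_ball by blast
  \<comment> \<open>Enumeration by \<open>from_nat_into\<close> requires a nonempty set; the zero
    functional shows that the ball, and hence \<open>C\<close>, is nonempty.\<close>
  have "C \<noteq> {}"
    using C(3) zero_in_dual_unit_ball[of K, where 'k = 'k] by (auto simp: closure_of_empty)
  have sep: "\<exists>\<psi>\<in>C. \<psi> f \<noteq> 0" if f: "f \<in> cont_space K" and p: "p \<in> topspace K" "f p \<noteq> 0" for f p
  proof -
    define T where "T = {\<psi> \<in> topspace ?W. \<psi> f \<in> - {0}}"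
    have "continuous_map ?W euclidean (\<lambda>\<psi>. \<psi> f)"
      unfolding weak_star_unit_ball_def
      using f by (intro continuous_map_from_subtopology continuous_map_product_projection)
    then have "openin ?W T"
      unfolding T_def by (rule openin_continuous_map_preimage) auto
    moreover have "(\<lambda>f\<in>cont_space K. f p) \<in> T"
      using evaluation_in_dual_unit_ball[OF p(1)] p f by (simp add: T_def topspace_weak_star_unit_ball)
    moreover have "(\<lambda>f\<in>cont_space K. f p) \<in> ?W closure_of C"
      using evaluation_in_dual_unit_ball[OF p(1)] C(3) by simp
    ultimately obtain \<psi> where "\<psi> \<in> C" "\<psi> \<in> T"
      by (metis in_closure_of)
    then show ?thesis
      by (auto simp: T_def)
  qed
  show ?thesis
  proof (intro exI[of _ "from_nat_into C"] conjI ballI allI impI)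
    show "from_nat_into C n \<in> dual_unit_ball K" for n
      using from_nat_into[OF \<open>C \<noteq> {}\<close>] C(2) by blast
    show "\<exists>n. from_nat_into C n f \<noteq> 0"
      if "f \<in> cont_space K" "p \<in> topspace K" "f p \<noteq> 0" for f p
      using sep[OF that] C(1) by (metis from_nat_into_surj)
  qed
qed

text \<open>No point of the support contains a null set, so limits along such points annihilate
  sequences that are null modulo the ideal.\<close>

lemma null_functional_support:
  fixes U :: "nat filter" and \<psi> :: "(nat filter \<Rightarrow> 'k::{real_normed_field,euclidean_space}) \<Rightarrow> 'k"
  defines "K \<equiv> subtopology beta_omega (measure_support beta_omega (density_measure U))"
  assumes U: "free_ultrafilter U" and \<psi>: "\<psi> \<in> dual_unit_ball K"
  shows "null_functional U (\<lambda>x. \<psi> (\<lambda>p\<in>topspace K. Lim p x)) 1"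
proof -
  have topK: "topspace K = measure_support beta_omega (density_measure U)"
    by (auto simp: K_def measure_support_def)
  have ultra: "ultrafilter p" if "p \<in> topspace K" for p
    using that by (auto simp: topK measure_support_def topspace_beta_omega)
  have cont: "(\<lambda>p\<in>topspace K. Lim p x) \<in> cont_space K" if "bounded (range x)" for x :: "nat \<Rightarrow> 'k"
    unfolding K_def
    by (intro restrict_in_cont_space continuous_map_from_subtopology continuous_map_Lim that)
  note lim = ultrafilter_tendsto_Lim[OF ultra]
  note LimI = tendsto_Lim[OF ultrafilterD_neq_bot[OF ultra]]
  show ?thesis
  proof
    show "free_ultrafilter U" by (rule U)
    fix x :: "nat \<Rightarrow> 'k"
    show "\<psi> (\<lambda>p\<in>topspace K. Lim p (\<lambda>i. x i + y i)) =
        \<psi> (\<lambda>p\<in>topspace K. Lim p x) + \<psi> (\<lambda>p\<in>topspace K. Lim p y)"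
      if "bounded (range x)" "bounded (range y)" for y
    proof -
      \<comment> \<open>The inner restrictions give the summands the extensional form that
        \<open>dual_unit_ball\<close> expects of members of \<open>cont_space K\<close>.\<close>
      have eq: "(\<lambda>p\<in>topspace K. Lim p (\<lambda>i. x i + y i)) =
          (\<lambda>p\<in>topspace K. (\<lambda>p\<in>topspace K. Lim p x) p + (\<lambda>p\<in>topspace K. Lim p y) p)"
        using that by (intro restrict_ext) (simp add: LimI tendsto_add lim)
      show ?thesis
        unfolding eq using \<psi> cont that unfolding dual_unit_ball_def by blast
    qed
    show scale: "\<psi> (\<lambda>p\<in>topspace K. Lim p (\<lambda>i. c * x i)) = c * \<psi> (\<lambda>p\<in>topspace K. Lim p x)"
      if "bounded (range x)" for c
    proof -
      have eq: "(\<lambda>p\<in>topspace K. Lim p (\<lambda>i. c * x i)) =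
          (\<lambda>p\<in>topspace K. c * (\<lambda>p\<in>topspace K. Lim p x) p)"
        using that by (intro restrict_ext) (simp add: LimI tendsto_mult_left lim)
      show ?thesis
        unfolding eq using \<psi> cont that unfolding dual_unit_ball_def by blast
    qed
    show "norm (\<psi> (\<lambda>p\<in>topspace K. Lim p x)) \<le> 1" if x: "\<And>i. norm (x i) \<le> 1"
    proof -
      have bdd: "bounded (range x)"
        using x by (intro boundedI) auto
      have "norm (Lim p x) \<le> 1" if "p \<in> topspace K" for p
        by (rule tendsto_upperbound[OF tendsto_norm[OF lim[OF that bdd]]])
           (use x ultrafilterD_neq_bot[OF ultra[OF that]] in auto)
      then have "\<forall>p\<in>topspace K. norm ((\<lambda>p\<in>topspace K. Lim p x) p) \<le> 1"
        by simp
      with \<psi> cont[OF bdd] show ?thesis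
        unfolding dual_unit_ball_def by blast
    qed
    show "\<psi> (\<lambda>p\<in>topspace K. Lim p x) = 0"
      if x: "bounded (range x)" and null: "\<And>e. 0 < e \<Longrightarrow> density U {i. e \<le> norm (x i)} = 0"
    proof -
      have "Lim p x = 0" if p: "p \<in> topspace K" for p
      proof (rule LimI[OF p], rule tendstoI)
        fix e :: real assume "0 < e"
        then have "p \<notin> hat {i. e \<le> norm (x i)}"
          using not_in_hat_if_in_support[OF U] null p by (simp add: topK)
        then have "\<forall>\<^sub>F i in p. \<not> e \<le> norm (x i)"
          using ultra[OF p] by (simp add: hat_def eventually_ultrafilter_not_iff)
        then show "\<forall>\<^sub>F i in p. dist (x i) 0 < e"
          by (simp add: not_le)
      qed
      \<comment> \<open>The zero function is written as the multiple by 0, so that homogeneity gives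
        the value 0.\<close>
      then have "(\<lambda>p\<in>topspace K. Lim p x) = (\<lambda>p\<in>topspace K. Lim p (\<lambda>i. 0 * x i))"
        by (intro restrict_ext) (simp add: LimI)
      then show ?thesis
        using scale[OF x, of 0] by simp
    qed
  qed
qed

text \<open>The annihilated sequence exceeds \<open>e\<close> on a non-null set, which some point of
  the support contains. Its limit function is thus nonzero there, against separation.\<close>

lemma support_not_approximable:
  fixes t :: "nat \<Rightarrow> nat" and U :: "nat filter"
  defines "K \<equiv> subtopology beta_omega (measure_support beta_omega (density_measure U))"
  assumes sparse: "strict_mono t" "(\<lambda>j. real (t j) / real (t (Suc j))) \<longlonglongrightarrow> 0"
    and U: "free_ultrafilter U" and T: "\<forall>\<^sub>F n in U. n \<in> range t"
  shows "\<not> approximable TYPE('k::{real_normed_field,euclidean_space}) K"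
proof
  assume "approximable TYPE('k) K"
  then obtain \<psi> :: "nat \<Rightarrow> (nat filter \<Rightarrow> 'k) \<Rightarrow> 'k"
    where \<psi>: "\<forall>n. \<psi> n \<in> dual_unit_ball K"
      and sep: "\<forall>f\<in>cont_space K. \<forall>p\<in>topspace K. f p \<noteq> 0 \<longrightarrow> (\<exists>n. \<psi> n f \<noteq> 0)"
    using approximable_imp_separating by blast
  have "null_functional U (\<lambda>x. \<psi> n (\<lambda>p\<in>topspace K. Lim p x)) 1" for n
    using null_functional_support[OF U] \<psi> unfolding K_def by blast
  then obtain x :: "nat \<Rightarrow> 'k" and e where x: "bounded (range x)" and e: "0 < e"
    and dens: "density U {i. e \<le> norm (x i)} \<noteq> 0"
    and zero: "\<And>n. \<psi> n (\<lambda>p\<in>topspace K. Lim p x) = 0"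
    by (rule null_functionals_not_separating[OF sparse T,
          of "\<lambda>n x. \<psi> n (\<lambda>p\<in>topspace K. Lim p x)" "\<lambda>_. 1"]) auto
  obtain p where p: "p \<in> measure_support beta_omega (density_measure U)" "p \<in> hat {i. e \<le> norm (x i)}"
    using ex_in_support_hat[OF U dens] by blast
  then have ultra: "ultrafilter p" and ev: "\<forall>\<^sub>F i in p. e \<le> norm (x i)"
    by (auto simp: hat_def)
  have pK: "p \<in> topspace K"
    using p(1) by (auto simp: K_def measure_support_def)
  have "e \<le> norm (Lim p x)"
    by (rule tendsto_lowerbound[OF tendsto_norm[OF ultrafilter_tendsto_Lim[OF ultra x]] ev
          ultrafilterD_neq_bot[OF ultra]])
  then have "(\<lambda>p\<in>topspace K. Lim p x) p \<noteq> 0"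
    using e pK by auto
  moreover have "(\<lambda>p\<in>topspace K. Lim p x) \<in> cont_space K"
    unfolding K_def
    by (intro restrict_in_cont_space continuous_map_from_subtopology continuous_map_Lim x)
  ultimately show False
    using sep pK zero by blast
qed

section \<open>Complementability\<close>

lemma apply_Bcontfun_nat:
  "bounded (range x) \<Longrightarrow> apply_bcontfun (Bcontfun x) = (x :: nat \<Rightarrow> 'k::metric_space)"
  by (simp add: Bcontfun_inverse bcontfun_def)

text \<open>These are the coordinates of the complementary projection: they vanish wherever
  \<open>P\<close> acts as the identity.\<close>

lemma null_functional_projection:
  fixes P :: "'k::{real_normed_field,real_inner} linfty \<Rightarrow> 'k linfty"
  assumes U: "free_ultrafilter U" and P: "bounded_linear P"
    and hom: "\<And>c x. P (linfty_scale c x) = linfty_scale c (P x)"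
    and fixed: "\<And>x. x \<in> c0_ideal (null_ideal U) \<Longrightarrow> P x = x"
  shows "null_functional U (\<lambda>x. x n - apply_bcontfun (P (Bcontfun x)) n) (1 + onorm P)"
proof
  show "free_ultrafilter U" by (rule U)
  fix x :: "nat \<Rightarrow> 'k"
  show "x n + y n - apply_bcontfun (P (Bcontfun (\<lambda>i. x i + y i))) n =
      x n - apply_bcontfun (P (Bcontfun x)) n + (y n - apply_bcontfun (P (Bcontfun y)) n)"
    if "bounded (range x)" "bounded (range y)" for y
  proof -
    have "Bcontfun (\<lambda>i. x i + y i) = Bcontfun x + Bcontfun y"
      using that by (intro bcontfun_eqI) (simp add: apply_Bcontfun_nat bounded_plus_comp plus_bcontfun.rep_eq)
    then show ?thesis
      using bounded_linear.linear[OF P] by (simp add: linear_add plus_bcontfun.rep_eq)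
  qed
  show "c * x n - apply_bcontfun (P (Bcontfun (\<lambda>i. c * x i))) n =
      c * (x n - apply_bcontfun (P (Bcontfun x)) n)" if "bounded (range x)" for c
  proof -
    have "bounded (range (\<lambda>i. c * x i))"
      using bounded_linear_image[OF that bounded_linear_mult_right[of c]] by (simp add: image_image)
    then have "Bcontfun (\<lambda>i. c * x i) = linfty_scale c (Bcontfun x)"
      using that by (intro bcontfun_eqI) (simp add: apply_Bcontfun_nat)
    then show ?thesis
      by (simp add: hom right_diff_distrib)
  qed
  show "norm (x n - apply_bcontfun (P (Bcontfun x)) n) \<le> 1 + onorm P" if x: "\<And>i. norm (x i) \<le> 1"
  proof -
    have "bounded (range x)"
      using x by (intro boundedI) auto
    then have "norm (Bcontfun x) \<le> 1"
      using x by (intro norm_bound) (simp add: apply_Bcontfun_nat)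
    have "norm (apply_bcontfun (P (Bcontfun x)) n) \<le> norm (P (Bcontfun x))"
      by (rule norm_bounded)
    also have "\<dots> \<le> onorm P * norm (Bcontfun x)"
      by (rule onorm[OF P])
    also have "\<dots> \<le> onorm P"
      using \<open>norm (Bcontfun x) \<le> 1\<close> onorm_pos_le[OF P] by (simp add: mult_left_le)
    finally show ?thesis
      using x[of n] norm_triangle_ineq4[of "x n" "apply_bcontfun (P (Bcontfun x)) n"] by linarith
  qed
  show "x n - apply_bcontfun (P (Bcontfun x)) n = 0"
    if x: "bounded (range x)" and "\<And>e. 0 < e \<Longrightarrow> density U {i. e \<le> norm (x i)} = 0"
  proof -
    have "Bcontfun x \<in> c0_ideal (null_ideal U)"
      using that by (simp add: c0_ideal_def null_ideal_def apply_Bcontfun_nat)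
    then show ?thesis
      using fixed x by (simp add: apply_Bcontfun_nat)
  qed
qed

text \<open>A sequence annihilated by all coordinates of \<open>x - P x\<close> is fixed by
  \<open>P\<close>, so it lies in the range; but the one found is not null modulo the ideal.\<close>

lemma c0_null_ideal_not_complemented:
  fixes t :: "nat \<Rightarrow> nat" and U :: "nat filter"
  assumes sparse: "strict_mono t" "(\<lambda>j. real (t j) / real (t (Suc j))) \<longlonglongrightarrow> 0"
    and U: "free_ultrafilter U" and T: "\<forall>\<^sub>F n in U. n \<in> range t"
  shows "\<not> complemented (c0_ideal (null_ideal U) :: 'k::{real_normed_field,real_inner} linfty set)"
proof
  let ?c0 = "c0_ideal (null_ideal U) :: 'k linfty set"
  assume "complemented ?c0"
  then obtain P :: "'k linfty \<Rightarrow> 'k linfty" where P: "bounded_linear P"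
    and hom: "\<And>c x. P (linfty_scale c x) = linfty_scale c (P x)"
    and idem: "P \<circ> P = P" and range: "range P = ?c0"
    unfolding complemented_def by blast
  have "P x = x" if "x \<in> ?c0" for x
    using that idem unfolding range[symmetric] by (metis comp_apply rangeE)
  then have "null_functional U (\<lambda>x. x n - apply_bcontfun (P (Bcontfun x)) n) (1 + onorm P)" for n
    using null_functional_projection[OF U P hom] by blast
  then obtain x :: "nat \<Rightarrow> 'k" and e where x: "bounded (range x)" and e: "0 < e"
    and dens: "density U {i. e \<le> norm (x i)} \<noteq> 0"
    and zero: "\<And>n. x n - apply_bcontfun (P (Bcontfun x)) n = 0"
    by (rule null_functionals_not_separating[OF sparse T,
          of "\<lambda>n x. x n - apply_bcontfun (P (Bcontfun x)) n" "\<lambda>_. 1 + onorm P"]) auto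
  have "P (Bcontfun x) = Bcontfun x"
    using zero x by (intro bcontfun_eqI) (simp add: apply_Bcontfun_nat)
  then have "Bcontfun x \<in> ?c0"
    using range by (metis rangeI)
  with e dens x show False
    by (simp add: c0_ideal_def null_ideal_def apply_Bcontfun_nat)
qed

theorem corollary6p11:
  fixes t :: "nat \<Rightarrow> nat" and T :: "nat set" and U :: "nat filter"
  assumes "strict_mono t" and "T = range t"
    and "(\<lambda>j. real (t j) / real (t (Suc j))) \<longlonglongrightarrow> 0"
    and "free_ultrafilter U" and "\<forall>\<^sub>F n in U. n \<in> T"
  defines "K \<equiv> subtopology beta_omega (measure_support beta_omega (density_measure U))"
  shows "\<not> approximable TYPE(real) K \<and> \<not> approximable TYPE(complex) K \<and>
    \<not> complemented (c0_ideal (null_ideal U) :: real linfty set) \<and>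
    \<not> complemented (c0_ideal (null_ideal U) :: complex linfty set)"
  using assms(1,3-5) unfolding K_def \<open>T = range t\<close>
  by (intro conjI support_not_approximable c0_null_ideal_not_complemented)

end
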